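(* Let $\Im$ denote the set of simple Euclidean arrangements of pseudolines that have exactly one $(\ge 5)$-gon and in which every pseudoline is adjacent to (that is, contains an edge of) this unique $(\ge 5)$-gon. Then there are exponentially many non-isomorphic arrangements of $\Im$.
   Context: A pseudoline in the projective plane $\mathbb{P}$ is a simple noncontractible closed curve; an arrangement of pseudolines in $\mathbb{P}$ is a collection $\{p_0,p_1,\ldots,p_n\}$ of pseudolines that pairwise intersect (necessarily cross) exactly once. Since $\mathbb{P}\setminus p_0$ is homeomorphic to the Euclidean plane $\mathbb{E}$, one regards $\{p_1,\ldots,p_n\}$ as an arrangement of pseudolines in $\mathbb{E}$ (a Euclidean arrangement). An arrangement is simple if no point belongs to more than two pseudolines. The polygons of the arrangement are (the interiors of) its bounded cells; a $(\ge 5)$-gon is a polygon with at least $5$ edges. Having exactly one $(\ge 5)$-gon means that every bounded cell, except one, is either a triangle or a quadrilateral. Two Euclidean arrangements are isomorphic (combinatorially equivalent) if there is an incidence- and dimension-preserving bijection between their induced cell decompositions. *)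

theory Defs
  imports "HOL-Analysis.Analysis"
begin

(* The real projective plane as a subspace of real^3^3: the line through the unit vector v is
   represented by the matrix v v^T of the orthogonal projection onto it. By the lemmas
   proj_point_eq_iff and quotient_map_proj_point this is the unit sphere with antipodal points
   identified, carrying the quotient topology. *)

definition proj_point :: "real^3 \<Rightarrow> real^3^3"
  where "proj_point v = (\<chi> i j. v $ i * v $ j)"

definition proj_plane :: "(real^3^3) set"
  where "proj_plane = proj_point ` sphere 0 1"

lemma proj_point_mult_vec: "proj_point v *v w = (v \<bullet> w) *\<^sub>R v"
  by (simp add: proj_point_def matrix_vector_mult_def inner_vec_def vec_eq_iff
      sum_distrib_left algebra_simps)

lemma proj_point_eq_iff:
  assumes "v \<in> sphere 0 1" "w \<in> sphere 0 1"
  shows "proj_point v = proj_point w \<longleftrightarrow> v = w \<or> v = - w"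
proof
  assume eq: "proj_point v = proj_point w"
  have nv: "norm v = 1" and nw: "norm w = 1" using assms by auto
  have "proj_point v *v v = v" using nv by (simp add: proj_point_mult_vec dot_square_norm)
  then have v: "v = (w \<bullet> v) *\<^sub>R w" using eq by (simp add: proj_point_mult_vec)
  then have "norm v = \<bar>w \<bullet> v\<bar> * norm w" by (metis norm_scaleR)
  then have "w \<bullet> v = 1 \<or> w \<bullet> v = -1" using nv nw by auto
  then show "v = w \<or> v = - w" using v by (metis scaleR_one scaleR_minus_left)
qed (auto simp: proj_point_def)

lemma continuous_on_proj_point: "continuous_on S proj_point"
  unfolding proj_point_def by (intro continuous_intros)

lemma quotient_map_proj_point:
  "quotient_map (top_of_set (sphere 0 1)) (top_of_set proj_plane) proj_point"
proof (rule continuous_imp_quotient_map)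
  show "continuous_map (top_of_set (sphere 0 1)) (top_of_set proj_plane) proj_point"
    by (auto simp: continuous_on_proj_point proj_plane_def)
qed (auto simp: proj_plane_def compact_space_subtopology Hausdorff_space_subtopology
    Hausdorff_space_euclidean)


definition pseudoline :: "(real^3^3) set \<Rightarrow> bool"
  where "pseudoline p \<longleftrightarrow> (\<exists>g. simple_path g \<and> pathfinish g = pathstart g \<and>
      path_image g = p \<and> p \<subseteq> proj_plane \<and>
      \<not> (\<exists>a. homotopic_loops proj_plane g (linepath a a)))"

definition proj_arrangement :: "(real^3^3) set set \<Rightarrow> bool"
  where "proj_arrangement A \<longleftrightarrow> finite A \<and> (\<forall>p\<in>A. pseudoline p) \<and>
      (\<forall>p\<in>A. \<forall>q\<in>A. p \<noteq> q \<longrightarrow> (\<exists>!x. x \<in> p \<inter> q))"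

definition simple_proj_arrangement :: "(real^3^3) set set \<Rightarrow> bool"
  where "simple_proj_arrangement A \<longleftrightarrow>
      proj_arrangement A \<and> (\<forall>x. card {p \<in> A. x \<in> p} \<le> 2)"

(* Simplicity is a condition on the whole projective arrangement, including the
   pseudoline p0 that is removed: any two pseudolines of a simple Euclidean
   arrangement cross in the Euclidean plane. *)

definition simple_euclidean_arrangement :: "(real^2) set set \<Rightarrow> bool"
  where "simple_euclidean_arrangement L \<longleftrightarrow>
      (\<exists>p0 B h k. p0 \<notin> B \<and> simple_proj_arrangement (insert p0 B) \<and>
        homeomorphism (proj_plane - p0) UNIV h k \<and>
        L = (\<lambda>p. h ` (p - p0)) ` B)"


(* The open cells of the induced decomposition of the plane, by dimension. *)

definition vertices :: "(real^2) set set \<Rightarrow> (real^2) set"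
  where "vertices L = {v. \<exists>p\<in>L. \<exists>q\<in>L. p \<noteq> q \<and> v \<in> p \<inter> q}"

definition edges :: "(real^2) set set \<Rightarrow> (real^2) set set"
  where "edges L = (\<Union>p\<in>L. components (p - vertices L))"

definition faces :: "(real^2) set set \<Rightarrow> (real^2) set set"
  where "faces L = components (- \<Union>L)"

definition cells :: "(real^2) set set \<Rightarrow> nat \<Rightarrow> (real^2) set set"
  where "cells L d = (if d = 0 then (\<lambda>v. {v}) ` vertices L
      else if d = 1 then edges L else if d = 2 then faces L else {})"

definition all_cells :: "(real^2) set set \<Rightarrow> (real^2) set set"
  where "all_cells L = (\<Union>d. cells L d)"

definition isomorphic_arrangements :: "(real^2) set set \<Rightarrow> (real^2) set set \<Rightarrow> bool"
  where "isomorphic_arrangements L M \<longleftrightarrow>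
      (\<exists>f. bij_betw f (all_cells L) (all_cells M) \<and>
        (\<forall>d. f ` cells L d = cells M d) \<and>
        (\<forall>c\<in>all_cells L. \<forall>c'\<in>all_cells L.
          c \<subseteq> closure c' \<longleftrightarrow> f c \<subseteq> closure (f c')))"


definition polygons :: "(real^2) set set \<Rightarrow> (real^2) set set"
  where "polygons L = {c \<in> faces L. bounded c}"

definition edges_of :: "(real^2) set set \<Rightarrow> (real^2) set \<Rightarrow> (real^2) set set"
  where "edges_of L c = {e \<in> edges L. e \<subseteq> closure c}"

definition is_ge5gon :: "(real^2) set set \<Rightarrow> (real^2) set \<Rightarrow> bool"
  where "is_ge5gon L c \<longleftrightarrow> c \<in> polygons L \<and> 5 \<le> card (edges_of L c)"

definition adjacent_to :: "(real^2) set set \<Rightarrow> (real^2) set \<Rightarrow> (real^2) set \<Rightarrow> bool"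
  where "adjacent_to L p c \<longleftrightarrow> (\<exists>e\<in>edges_of L c. e \<subseteq> p)"

definition one_ge5gon_arrangements :: "(real^2) set set set"
  where "one_ge5gon_arrangements = {L. simple_euclidean_arrangement L \<and>
      (\<exists>!c. is_ge5gon L c) \<and>
      (\<forall>c. is_ge5gon L c \<longrightarrow> (\<forall>p\<in>L. adjacent_to L p c))}"

end

theory Submission
  imports Defs
begin

text \<open>
  Take \<open>n\<close> pairwise nonparallel tangents of the unit circle. A point outside the circle is determined
  by the arc of the circle that it sees, so a face other than the central one is a set of arcs whose
  two endpoints each move between consecutive tangent points: it has at most four edges, while every
  line contributes an edge to the central face.

  Now fix the \<open>n\<close> directions \<open>i * pi / n\<close> and choose for each one of the two tangents. The \<open>2 * n\<close> ends of
  the lines appear at infinity in the same cyclic order for every choice, and two consecutive ends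
  share their outermost vertex exactly when the choice changes there from \<open>1\<close> to \<open>-1\<close>. An isomorphism
  permutes the ends by a dihedral symmetry and preserves this cyclic pattern, which determines the
  choice. Hence at most \<open>4 * n\<close> of the \<open>2 ^ (n - 3)\<close> admissible choices are isomorphic to a given one.
\<close>

section \<open>Straight lines in the projective plane\<close>

text \<open>An isomorphism is only a bijection of cells that respects incidence, so boundedness and
  the order at infinity have to be recovered from incidences. An end of a line is an edge with at
  most one incident vertex, and two distinct ends are neighbours at infinity when a common face is
  incident to both. An isomorphism therefore moves neighbouring ends to neighbouring ends, and its
  injectivity forbids turning back, which leaves only rotations and reflections of the cycle of
  ends. The visible pattern shows the sign changes in one direction only. Nothing is lost: the two
  ends of a line carry opposite signs, so a change from \<open>-1\<close> to \<open>1\<close> at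
  \<open>j\<close> appears as a change from \<open>1\<close> to \<open>-1\<close> at
  \<open>j + n\<close>. One known sign then starts the reconstruction. All arrangements used are
  straight, with \<open>p0\<close> the line at infinity. Projective simplicity thus also demands
  that no two of the lines are parallel.\<close>

definition proj_line :: "real^3 \<Rightarrow> (real^3^3) set"
  where "proj_line a = proj_point ` {v \<in> sphere 0 1. a \<bullet> v = 0}"

lemma continuous_on_matrix_vector_mult [continuous_intros]:
  fixes f :: "'a::topological_space \<Rightarrow> real^'n^'m"
  assumes "continuous_on S f"
  shows "continuous_on S (\<lambda>x. f x *v w)"
  unfolding matrix_vector_mult_def by (intro continuous_intros assms)

lemma proj_point_minus: "proj_point (- v) = proj_point v"
  by (simp add: proj_point_def)

text \<open>The lines not orthogonal to \<open>w\<close> form an evenly covered neighbourhood of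
  \<open>proj_point w\<close>; its sheets are the open hemispheres around \<open>w\<close> and
  \<open>- w\<close>. The covering is used to see that projective lines are not
  contractible.\<close>

lemma covering_space_proj_point: "covering_space (sphere 0 1) proj_point proj_plane"
  unfolding covering_space_def
proof (intro conjI ballI)
  show "continuous_on (sphere 0 1) proj_point" by (rule continuous_on_proj_point)
  show "proj_point ` sphere 0 1 = proj_plane" by (simp add: proj_plane_def)
  fix P assume "P \<in> proj_plane"
  then obtain w :: "real^3" where w: "norm w = 1" "P = proj_point w"
    by (auto simp: proj_plane_def)
  define T where "T = {Q \<in> proj_plane. w \<bullet> (Q *v w) > 0}"
  define U where "U = (\<lambda>e::real. {v \<in> sphere 0 1. e * (v \<bullet> w) > 0})"
  \<comment> \<open>For \<open>Q = proj_point v\<close> the vector \<open>Q *v w\<close> is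
    \<open>(v \<bullet> w) *\<^sub>R v\<close>, and the square root is
    \<open>\<bar>v \<bullet> w\<bar>\<close>. The quotient is \<open>v\<close> up to sign, and
    \<open>e\<close> selects the sheet.\<close>
  define q where "q = (\<lambda>(e::real) Q. (e / sqrt (w \<bullet> (Q *v w))) *\<^sub>R (Q *v w))"
  have quad: "w \<bullet> (proj_point v *v w) = (v \<bullet> w)\<^sup>2" for v
    by (simp add: proj_point_mult_vec power2_eq_square inner_commute)
  have "P \<in> T"
    using w \<open>P \<in> proj_plane\<close> by (simp add: T_def quad dot_square_norm)
  moreover have "openin (top_of_set proj_plane) T"
  proof -
    have "T = proj_plane \<inter> {Q. w \<bullet> (Q *v w) > 0}" by (auto simp: T_def)
    moreover have "open {Q. w \<bullet> (Q *v w) > 0}"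
      by (intro open_Collect_less continuous_intros)
    ultimately show ?thesis by auto
  qed
  moreover have "\<Union> {U 1, U (-1)} = sphere 0 1 \<inter> proj_point -` T"
    by (auto simp: U_def T_def proj_plane_def quad)
  moreover have "openin (top_of_set (sphere 0 1)) (U e)" for e
  proof -
    have "U e = sphere 0 1 \<inter> {v. e * (v \<bullet> w) > 0}" by (auto simp: U_def)
    moreover have "open {v. e * (v \<bullet> w) > 0}"
      by (intro open_Collect_less continuous_intros)
    ultimately show ?thesis by auto
  qed
  moreover have "pairwise disjnt {U 1, U (-1)}"
    by (auto simp: pairwise_def disjnt_def U_def)
  moreover have "homeomorphism (U e) T proj_point (q e)" if e: "e = 1 \<or> e = -1" for e
  proof (rule homeomorphismI)
    show "continuous_on (U e) proj_point" by (rule continuous_on_proj_point)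
    show "continuous_on T (q e)"
      unfolding q_def T_def
      by (intro continuous_intros) auto
    show "proj_point ` U e \<subseteq> T"
      by (auto simp: U_def T_def proj_plane_def quad)
    show inv: "q e (proj_point v) = v" if "v \<in> U e" for v
    proof -
      have "sqrt ((v \<bullet> w)\<^sup>2) = e * (v \<bullet> w)" using that e by (auto simp: U_def)
      then have "q e (proj_point v) = (e / (e * (v \<bullet> w))) *\<^sub>R ((v \<bullet> w) *\<^sub>R v)"
        unfolding q_def quad by (simp only: proj_point_mult_vec)
      then show ?thesis using that e by (auto simp: U_def)
    qed
    have surj: "\<exists>v\<in>U e. Q = proj_point v" if Q: "Q \<in> T" for Q
    proof -
      obtain v where v: "norm v = 1" "Q = proj_point v"
        using Q by (auto simp: T_def proj_plane_def)
      have "v \<bullet> w \<noteq> 0" using Q v by (auto simp: T_def quad)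
      then have "v \<in> U e \<or> - v \<in> U e" using e v by (auto simp: U_def)
      then show ?thesis using v by (metis proj_point_minus)
    qed
    show "q e ` T \<subseteq> U e" using surj inv by force
    show "proj_point (q e Q) = Q" if "Q \<in> T" for Q
      using surj[OF that] inv by auto
  qed
  ultimately show "\<exists>T. P \<in> T \<and> openin (top_of_set proj_plane) T \<and>
      (\<exists>v. \<Union> v = sphere 0 1 \<inter> proj_point -` T \<and>
        (\<forall>u\<in>v. openin (top_of_set (sphere 0 1)) u) \<and> pairwise disjnt v \<and>
        (\<forall>u\<in>v. \<exists>q. homeomorphism u T proj_point q))"
    by (intro exI[of _ T] exI[of _ "{U 1, U (-1)}"] conjI) blast+
qed

lemma orthonormal_complement_3:
  fixes a :: "real^3"
  assumes "a \<noteq> 0"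
  obtains u w where "norm u = 1" "norm w = 1" "u \<bullet> w = 0" "a \<bullet> u = 0" "a \<bullet> w = 0"
    "\<And>v. a \<bullet> v = 0 \<Longrightarrow> v = (v \<bullet> u) *\<^sub>R u + (v \<bullet> w) *\<^sub>R w"
proof -
  obtain u0 where u0: "u0 \<noteq> 0" "orthogonal a u0"
    using orthogonal_to_vector_exists[of a] by auto
  define u where "u = u0 /\<^sub>R norm u0"
  have u: "norm u = 1" "a \<bullet> u = 0" using u0 by (auto simp: u_def orthogonal_def)
  have au: "cross3 a u \<noteq> 0"
    using norm_and_cross_eq_0[of a u] assms u by auto
  define w where "w = cross3 a u /\<^sub>R norm (cross3 a u)"
  have w: "norm w = 1" using au by (simp add: w_def)
  have uw: "u \<bullet> w = 0" and aw: "a \<bullet> w = 0" by (simp_all add: w_def dot_cross_self)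
  have "v = (v \<bullet> u) *\<^sub>R u + (v \<bullet> w) *\<^sub>R w" if "a \<bullet> v = 0" for v
  proof -
    define z where "z = v - ((v \<bullet> u) *\<^sub>R u + (v \<bullet> w) *\<^sub>R w)"
    have "z \<bullet> u = 0" "z \<bullet> w = 0" "z \<bullet> a = 0"
      using u w uw aw that
      by (simp_all add: z_def inner_diff_left inner_add_left dot_square_norm
            inner_commute[of w u] inner_commute[of u a] inner_commute[of w a] inner_commute[of v a])
    then have "z \<bullet> cross3 a u = 0" using au by (simp add: w_def)
    moreover have "cross3 z (cross3 a u) = 0"
      using \<open>z \<bullet> u = 0\<close> \<open>z \<bullet> a = 0\<close> by (simp add: Lagrange)
    ultimately have "z = 0" using norm_and_cross_eq_0[of z "cross3 a u"] au by auto
    then show ?thesis by (simp add: z_def)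
  qed
  with u w uw aw show thesis using that by blast
qed

text \<open>Half a great circle, from \<open>u\<close> to \<open>- u\<close>, projects to a simple
  loop that traverses the line once. Its lift ends at the antipode of its start, whereas monodromy
  would make the lift of a null-homotopic loop end where it starts.\<close>

lemma pseudoline_proj_line:
  assumes "a \<noteq> 0"
  shows "pseudoline (proj_line a)"
proof -
  obtain u w where uw: "norm u = 1" "norm w = 1" "u \<bullet> w = 0" "a \<bullet> u = 0" "a \<bullet> w = 0"
    and span: "\<And>v. a \<bullet> v = 0 \<Longrightarrow> v = (v \<bullet> u) *\<^sub>R u + (v \<bullet> w) *\<^sub>R w"
    using orthonormal_complement_3[OF assms] by blast
  define l where "l = (\<lambda>t::real. cos (pi * t) *\<^sub>R u + sin (pi * t) *\<^sub>R w)"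
  define g where "g = proj_point \<circ> l"
  have contl: "continuous_on S l" for S unfolding l_def by (intro continuous_intros)
  have lu: "l t \<bullet> u = cos (pi * t)" and lw: "l t \<bullet> w = sin (pi * t)" for t
    using uw by (simp_all add: l_def inner_add_left dot_square_norm inner_commute[of w u])
  have nl: "norm (l t) = 1" for t
  proof -
    have "l t \<bullet> l t = cos (pi * t) * (l t \<bullet> u) + sin (pi * t) * (l t \<bullet> w)"
      by (subst (2) l_def) (simp only: inner_add_right inner_scaleR_right)
    also have "\<dots> = 1" by (simp add: lu lw flip: power2_eq_square)
    finally show ?thesis by (simp add: norm_eq_1)
  qed
  have al: "a \<bullet> l t = 0" for t using uw by (simp add: l_def inner_add_right)
  have simple: "simple_path g"
    unfolding simple_path_def loop_free_def
  proof (intro conjI ballI impI)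
    show "path g" unfolding path_def g_def
      by (intro continuous_on_compose contl continuous_on_proj_point)
    fix x y assume xy: "x \<in> {0..1::real}" "y \<in> {0..1::real}" "g x = g y"
    then have "l x = l y \<or> l x = - l y"
      using proj_point_eq_iff[of "l x" "l y"] nl by (auto simp: g_def)
    then have "(l x \<bullet> w) * (l y \<bullet> u) = (l x \<bullet> u) * (l y \<bullet> w)"
      by (elim disjE) simp_all
    then have "sin (pi * x) * cos (pi * y) = cos (pi * x) * sin (pi * y)"
      by (simp only: lu lw)
    then have "sin (pi * (x - y)) = 0" by (simp add: right_diff_distrib sin_diff)
    then obtain i :: int where i: "pi * (x - y) = of_int i * pi"
      by (auto simp: sin_zero_iff_int2)
    then have "x - y = of_int i" by simp
    moreover have "\<bar>x - y\<bar> \<le> 1" using xy by auto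
    ultimately have "i = -1 \<or> i = 0 \<or> i = 1" by linarith
    then show "x = y \<or> x = 0 \<and> y = 1 \<or> x = 1 \<and> y = 0"
      using \<open>x - y = of_int i\<close> xy by auto
  qed
  have ends: "l 0 = u" "l 1 = - u" by (simp_all add: l_def)
  have loop: "pathfinish g = pathstart g"
    by (simp add: g_def pathfinish_def pathstart_def ends proj_point_def)
  have image: "path_image g = proj_line a"
  proof
    show "path_image g \<subseteq> proj_line a"
      using nl al by (auto simp: path_image_def g_def proj_line_def)
    show "proj_line a \<subseteq> path_image g"
    proof
      fix P assume "P \<in> proj_line a"
      then obtain v where v: "norm v = 1" "a \<bullet> v = 0" "P = proj_point v"
        by (auto simp: proj_line_def)
      have vv: "v = (v \<bullet> u) *\<^sub>R u + (v \<bullet> w) *\<^sub>R w" using span v by blast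
      have "1 = v \<bullet> ((v \<bullet> u) *\<^sub>R u + (v \<bullet> w) *\<^sub>R w)"
        using vv v by (metis dot_square_norm one_power2)
      then have one: "(v \<bullet> u)\<^sup>2 + (v \<bullet> w)\<^sup>2 = 1"
        by (simp add: inner_add_right power2_eq_square)
      \<comment> \<open>The half circle reaches only vectors with nonnegative \<open>w\<close>
        coordinate; the remaining points of the line are represented by \<open>- v\<close> instead
        of \<open>v\<close>.\<close>
      have mem: "proj_point (x *\<^sub>R u + y *\<^sub>R w) \<in> path_image g"
        if xy: "x\<^sup>2 + y\<^sup>2 = 1" "0 \<le> y" for x y
      proof -
        obtain t where t: "0 \<le> t" "t \<le> pi" "x = cos t" "y = sin t"
          using sincos_total_pi[OF xy(2,1)] by auto
        then have "x *\<^sub>R u + y *\<^sub>R w = l (t / pi)" by (simp add: l_def)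
        then show ?thesis using t unfolding path_image_def g_def
          by (intro image_eqI[of _ _ "t / pi"]) auto
      qed
      have "proj_point v = proj_point ((- (v \<bullet> u)) *\<^sub>R u + (- (v \<bullet> w)) *\<^sub>R w)"
        using vv proj_point_minus[of v] by (metis minus_add_distrib scaleR_minus_left)
      moreover have "proj_point v = proj_point ((v \<bullet> u) *\<^sub>R u + (v \<bullet> w) *\<^sub>R w)"
        using vv by (rule arg_cong)
      ultimately show "P \<in> path_image g"
        using mem[of "v \<bullet> u" "v \<bullet> w"] mem[of "- (v \<bullet> u)" "- (v \<bullet> w)"] one v(3)
        by (metis linear neg_0_le_iff_le power2_minus)
    qed
  qed
  have sub: "path_image g \<subseteq> proj_plane"
    using nl by (auto simp: path_image_def g_def proj_plane_def)
  have "\<not> homotopic_loops proj_plane g (linepath b b)" for b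
  proof
    assume "homotopic_loops proj_plane g (linepath b b)"
    then have "homotopic_paths proj_plane g (linepath (pathstart g) (pathstart g))"
      by (rule homotopic_loops_imp_homotopic_paths_null)
    moreover have "path (linepath u u)" "path l" using contl by (auto simp: path_def)
    moreover have "proj_point \<circ> linepath u u = linepath (pathstart g) (pathstart g)"
      by (simp add: fun_eq_iff g_def pathstart_def ends linepath_def flip: scaleR_add_left)
    moreover have "proj_point u \<in> proj_plane" using uw by (simp add: proj_plane_def)
    moreover have "path g" using simple by (rule simple_path_imp_path)
    moreover have "path_image l \<subseteq> sphere 0 1" using nl by (auto simp: path_image_def)
    moreover have "path_image (linepath u u) \<subseteq> sphere 0 1" using uw by simp
    moreover have "path_image (linepath (pathstart g) (pathstart g)) \<subseteq> proj_plane"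
      using \<open>proj_point u \<in> proj_plane\<close> by (simp add: g_def pathstart_def ends)
    moreover have "pathstart l = pathstart (linepath u u)"
      by (simp add: pathstart_def ends linepath_def)
    moreover have "\<And>t. proj_point (l t) = g t" "pathstart g = proj_point u"
      by (simp_all add: g_def pathstart_def ends)
    ultimately have "pathfinish l = pathfinish (linepath u u)"
      using sub
      by (intro covering_space_monodromy[OF covering_space_proj_point, of g
            "linepath (pathstart g) (pathstart g)"]) simp_all
    then have "- u = u" by (simp add: pathfinish_def ends linepath_def)
    then have "- (u \<bullet> u) = u \<bullet> u" by (metis inner_minus_left)
    then show False using uw by (simp add: dot_square_norm)
  qed
  then show ?thesis unfolding pseudoline_def using simple loop image sub by blast
qed

lemma proj_point_mem_proj_line_iff:
  assumes "norm v = 1"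
  shows "proj_point v \<in> proj_line a \<longleftrightarrow> a \<bullet> v = 0"
proof
  assume "proj_point v \<in> proj_line a"
  then obtain w where "norm w = 1" "a \<bullet> w = 0" "proj_point v = proj_point w"
    by (auto simp: proj_line_def)
  then show "a \<bullet> v = 0" using proj_point_eq_iff[of v w] assms by auto
qed (use assms in \<open>auto simp: proj_line_def\<close>)

text \<open>The common point is the direction of \<open>cross3 a b\<close>: by Lagrange's formula
  any vector orthogonal to both \<open>a\<close> and \<open>b\<close> has zero cross product with
  it.\<close>

lemma proj_line_Int_ex1:
  assumes "cross3 a b \<noteq> 0"
  shows "\<exists>!x. x \<in> proj_line a \<inter> proj_line b"
proof -
  define c where "c = cross3 a b /\<^sub>R norm (cross3 a b)"
  have c: "norm c = 1" "a \<bullet> c = 0" "b \<bullet> c = 0"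
    using assms by (simp_all add: c_def dot_cross_self)
  have uniq: "P = proj_point c" if P: "P \<in> proj_line a" "P \<in> proj_line b" for P
  proof -
    obtain v where v: "norm v = 1" "P = proj_point v"
      using P(1) by (auto simp: proj_line_def)
    then have "a \<bullet> v = 0" "b \<bullet> v = 0"
      using P by (auto simp: proj_point_mem_proj_line_iff)
    then have "cross3 v (cross3 a b) = 0" by (simp add: Lagrange inner_commute)
    then have "cross3 v c = 0" by (simp add: c_def cross_mult_right)
    then have "(v \<bullet> c)\<^sup>2 = 1" using norm_cross_dot[of v c] v c by simp
    then have "v \<bullet> c = 1 \<or> v \<bullet> c = -1" by (simp add: power2_eq_1_iff)
    moreover have "(v - c) \<bullet> (v - c) = 2 - 2 * (v \<bullet> c)" "(v + c) \<bullet> (v + c) = 2 + 2 * (v \<bullet> c)"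
      using v(1) c(1) unfolding norm_eq_1
      by (simp_all add: inner_diff_left inner_diff_right inner_add_left inner_add_right
          inner_commute[of c v])
    ultimately have "(v - c) \<bullet> (v - c) = 0 \<or> (v + c) \<bullet> (v + c) = 0" by auto
    then have "v = c \<or> v = - c" by (simp add: eq_neg_iff_add_eq_0)
    then show ?thesis using v by (auto simp: proj_point_minus)
  qed
  moreover have "proj_point c \<in> proj_line a \<inter> proj_line b"
    using c by (simp add: proj_point_mem_proj_line_iff)
  ultimately show ?thesis by blast
qed

text \<open>A projective line contains at least two points, given by an orthonormal basis of its
  plane, while the intersection of the two lines is a single point.\<close>

lemma proj_line_neq:
  assumes "cross3 a b \<noteq> 0"
  shows "proj_line a \<noteq> proj_line b"
proof
  assume eq: "proj_line a = proj_line b"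
  have "a \<noteq> 0" using assms by auto
  then obtain u w where uw: "norm u = 1" "norm w = 1" "u \<bullet> w = 0" "a \<bullet> u = 0" "a \<bullet> w = 0"
    using orthonormal_complement_3[of a] by metis
  then have "proj_point u \<in> proj_line a" "proj_point w \<in> proj_line a"
    by (auto simp: proj_point_mem_proj_line_iff)
  then have "proj_point u = proj_point w"
    using proj_line_Int_ex1[OF assms] eq by blast
  then have "u = w \<or> u = - w" using uw proj_point_eq_iff[of u w] by simp
  then show False using uw by (auto simp: dot_square_norm)
qed

section \<open>The affine chart of the projective plane off the line at infinity\<close>

definition chart :: "real^3^3 \<Rightarrow> real^2"
  where "chart P = vector [P $ 1 $ 3 / P $ 3 $ 3, P $ 2 $ 3 / P $ 3 $ 3]"

definition chart_inv :: "real^2 \<Rightarrow> real^3^3"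
  where "chart_inv x = proj_point (vector [x $ 1, x $ 2, 1] /\<^sub>R norm (vector [x $ 1, x $ 2, 1] :: real^3))"

text \<open>The matrix entries are products of coordinates, so the quotients
  \<open>v $ i * v $ 3 / (v $ 3 * v $ 3)\<close> reduce to the usual affine coordinates, and they do
  not see the sign of \<open>v\<close>.\<close>

lemma chart_proj_point:
  assumes "v $ 3 \<noteq> 0"
  shows "chart (proj_point v) = vector [v $ 1 / v $ 3, v $ 2 / v $ 3]"
  using assms by (simp add: chart_def proj_point_def)

lemma vector_3_neq_0: "(vector [x, y, 1] :: real^3) \<noteq> 0"
  by (metis vector_3(3) zero_index zero_neq_one)

lemma homeomorphism_chart:
  "homeomorphism (proj_plane - proj_line (axis 3 1)) UNIV chart chart_inv"
proof -
  let ?D = "proj_plane - proj_line (axis 3 1)"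
  have D: "\<exists>v. norm v = 1 \<and> v $ 3 \<noteq> 0 \<and> P = proj_point v" if "P \<in> ?D" for P
    using that by (auto simp: proj_plane_def proj_line_def inner_axis')
  have inv1: "chart_inv (chart P) = P" if P: "P \<in> ?D" for P
  proof -
    obtain v where v: "norm v = 1" "v $ 3 \<noteq> 0" "P = proj_point v" using D[OF P] by blast
    have *: "(vector [v $ 1 / v $ 3, v $ 2 / v $ 3, 1] :: real^3) = (1 / v $ 3) *\<^sub>R v"
      using v by (simp add: vec_eq_iff forall_3)
    have "chart_inv (chart P) = proj_point (sgn (v $ 3) *\<^sub>R v)"
      unfolding chart_inv_def v(3) chart_proj_point[OF v(2)] using v
      by (simp add: * sgn_real_def)
    then show ?thesis using v by (auto simp: sgn_real_def proj_point_minus)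
  qed
  have inv2: "chart (chart_inv x) = x" and mem: "chart_inv x \<in> ?D" for x
  proof -
    define w :: "real^3" where "w = vector [x $ 1, x $ 2, 1]"
    have w: "w \<noteq> 0" by (simp add: w_def vector_3_neq_0)
    then have n: "norm w \<noteq> 0" by simp
    have comp: "w $ 1 = x $ 1" "w $ 2 = x $ 2" "w $ 3 = 1" by (simp_all add: w_def)
    have "chart_inv x = proj_point (w /\<^sub>R norm w)" by (simp add: chart_inv_def w_def)
    moreover have n1: "norm (w /\<^sub>R norm w) = 1" using w by simp
    moreover have n3: "(w /\<^sub>R norm w) $ 3 \<noteq> 0" using w comp by simp
    moreover have "proj_point (w /\<^sub>R norm w) \<in> ?D"
      using proj_point_mem_proj_line_iff[OF n1, of "axis 3 1"] n1 n3
      by (simp only: proj_plane_def inner_axis') auto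
    moreover have "chart (proj_point (w /\<^sub>R norm w)) = x"
      unfolding chart_proj_point[OF n3] using n comp by (simp add: vec_eq_iff forall_2)
    ultimately show "chart (chart_inv x) = x" "chart_inv x \<in> ?D" by simp_all
  qed
  have nz: "P $ 3 $ 3 \<noteq> 0" if "P \<in> ?D" for P
    using D[OF that] by (auto simp: proj_point_def)
  show ?thesis
  proof (rule homeomorphismI)
    have "chart = (\<lambda>P. \<chi> i. if i = 1 then P $ 1 $ 3 / P $ 3 $ 3 else P $ 2 $ 3 / P $ 3 $ 3)"
      by (simp add: fun_eq_iff vec_eq_iff forall_2 chart_def)
    moreover have "continuous_on ?D (\<lambda>P. \<chi> i::2. if i = 1 then P $ 1 $ 3 / P $ 3 $ 3 else P $ 2 $ 3 / P $ 3 $ 3)"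
    proof (rule continuous_on_vec_lambda)
      show "continuous_on ?D (\<lambda>P. if i = 1 then P $ 1 $ 3 / P $ 3 $ 3 else P $ 2 $ 3 / P $ 3 $ 3)"
        for i :: 2
        by (cases "i = 1") (auto intro!: continuous_intros simp: nz)
    qed
    ultimately show "continuous_on ?D chart" by metis
    have vec: "(\<lambda>x::real^2. vector [x $ 1, x $ 2, 1] :: real^3) =
        (\<lambda>x. \<chi> i. if i = 1 then x $ 1 else if i = 2 then x $ 2 else 1)"
      by (simp add: fun_eq_iff vec_eq_iff forall_3)
    have "continuous_on UNIV (\<lambda>x::real^2. vector [x $ 1, x $ 2, 1] :: real^3)"
      unfolding vec
    proof (rule continuous_on_vec_lambda)
      show "continuous_on UNIV (\<lambda>x::real^2. if i = 1 then x $ 1 else if i = 2 then x $ 2 else 1)"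
        for i :: 3
        by (cases "i = 1"; cases "i = 2") (auto intro!: continuous_intros)
    qed
    then have "continuous_on UNIV
        (\<lambda>x::real^2. (vector [x $ 1, x $ 2, 1] :: real^3) /\<^sub>R norm (vector [x $ 1, x $ 2, 1] :: real^3))"
      by (intro continuous_intros) (auto simp: vector_3_neq_0)
    then show "continuous_on UNIV chart_inv"
      unfolding chart_inv_def
      by (rule continuous_on_compose2[OF continuous_on_proj_point[of UNIV]]) auto
  qed (use inv1 inv2 mem in auto)
qed

lemma chart_image_proj_line:
  "chart ` (proj_line a - proj_line (axis 3 1)) = {x. a $ 1 * x $ 1 + a $ 2 * x $ 2 + a $ 3 = 0}"
proof (intro equalityI subsetI)
  fix x assume "x \<in> chart ` (proj_line a - proj_line (axis 3 1))"
  then obtain v where v: "norm v = 1" "a \<bullet> v = 0" "v $ 3 \<noteq> 0" "x = chart (proj_point v)"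
    by (auto simp: proj_line_def inner_axis')
  then show "x \<in> {x. a $ 1 * x $ 1 + a $ 2 * x $ 2 + a $ 3 = 0}"
    by (simp add: chart_proj_point inner_vec_def sum_3 divide_simps)
next
  fix x :: "real^2" assume x: "x \<in> {x. a $ 1 * x $ 1 + a $ 2 * x $ 2 + a $ 3 = 0}"
  define w :: "real^3" where "w = vector [x $ 1, x $ 2, 1]"
  have "w \<noteq> 0" by (simp add: w_def vector_3_neq_0)
  then have "norm (w /\<^sub>R norm w) = 1" by simp
  moreover have "a \<bullet> w = 0" using x by (simp add: w_def inner_vec_def sum_3)
  then have "a \<bullet> (w /\<^sub>R norm w) = 0" by (simp only: inner_scaleR_right mult_zero_right)
  ultimately have "chart_inv x \<in> proj_line a"
    by (auto simp: chart_inv_def proj_point_mem_proj_line_iff w_def)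
  moreover have "chart_inv x \<in> proj_plane - proj_line (axis 3 1)" "chart (chart_inv x) = x"
    using homeomorphism_chart by (auto simp: homeomorphism_def)
  ultimately show "x \<in> chart ` (proj_line a - proj_line (axis 3 1))"
    by (metis DiffD2 DiffI image_eqI)
qed

text \<open>Lines are given by homogeneous coefficient vectors, and \<open>axis 3 1\<close> is the
  line at infinity. Because it belongs to \<open>B\<close>, the assumption \<open>two\<close> at a
  vector with third coordinate zero says that no two lines of \<open>A\<close> are parallel.\<close>

lemma simple_euclidean_arrangement_lines:
  fixes A :: "(real^3) set"
  defines "B \<equiv> insert (axis 3 1) A"
  assumes "finite A" "axis 3 1 \<notin> A"
    and cross: "\<And>a b. a \<in> B \<Longrightarrow> b \<in> B \<Longrightarrow> a \<noteq> b \<Longrightarrow> cross3 a b \<noteq> 0"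
    and nz: "\<And>a. a \<in> B \<Longrightarrow> a \<noteq> 0"
    and two: "\<And>v. v \<noteq> 0 \<Longrightarrow> card {a \<in> B. a \<bullet> v = 0} \<le> 2"
  shows "simple_euclidean_arrangement
    ((\<lambda>a. {x. a $ 1 * x $ 1 + a $ 2 * x $ 2 + a $ 3 = 0}) ` A)"
  unfolding simple_euclidean_arrangement_def
proof (intro exI conjI)
  show "proj_line (axis 3 1) \<notin> proj_line ` A"
    using proj_line_neq cross assms(3) by (fastforce simp: B_def)
  show "homeomorphism (proj_plane - proj_line (axis 3 1)) UNIV chart chart_inv"
    by (rule homeomorphism_chart)
  show "(\<lambda>a. {x. a $ 1 * x $ 1 + a $ 2 * x $ 2 + a $ 3 = 0}) ` A =
      (\<lambda>p. chart ` (p - proj_line (axis 3 1))) ` proj_line ` A"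
    by (simp add: image_image chart_image_proj_line)
  have "proj_arrangement (proj_line ` B)"
    unfolding proj_arrangement_def
  proof (intro conjI ballI impI)
    show "finite (proj_line ` B)" using assms by (simp add: B_def)
    show "pseudoline p" if "p \<in> proj_line ` B" for p
      using that nz pseudoline_proj_line by auto
    fix p q assume "p \<in> proj_line ` B" "q \<in> proj_line ` B" "p \<noteq> q"
    then show "\<exists>!x. x \<in> p \<inter> q" using cross proj_line_Int_ex1 by blast
  qed
  moreover have "card {p \<in> proj_line ` B. P \<in> p} \<le> 2" for P
  proof (cases "P \<in> proj_plane")
    case True
    then obtain v where v: "norm v = 1" "P = proj_point v" by (auto simp: proj_plane_def)
    then have "{p \<in> proj_line ` B. P \<in> p} = proj_line ` {a \<in> B. a \<bullet> v = 0}"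
      by (auto simp: proj_point_mem_proj_line_iff)
    moreover have "finite {a \<in> B. a \<bullet> v = 0}" using assms(2) by (simp add: B_def)
    moreover have "v \<noteq> 0" using v by auto
    ultimately show ?thesis using two[of v] card_image_le[of "{a \<in> B. a \<bullet> v = 0}" proj_line]
      by simp
  next
    case False
    then have "{p \<in> proj_line ` B. P \<in> p} = {}" by (auto simp: proj_line_def proj_plane_def)
    then show ?thesis by (simp only: card.empty)
  qed
  ultimately have "simple_proj_arrangement (proj_line ` B)"
    by (simp add: simple_proj_arrangement_def)
  then show "simple_proj_arrangement (insert (proj_line (axis 3 1)) (proj_line ` A))"
    by (simp add: B_def)
qed

section \<open>Cells of a family of lines\<close>

lemma component_set_eq: "components S = (\<lambda>x. connected_component_set S x) ` S"
  by (auto simp: components_def)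

text \<open>Several indices may name the same line, as the integers \<open>i\<close> and
  \<open>i + n\<close> will below. Hence vertices are described by
  \<open>line i \<noteq> line j\<close> and not by \<open>i \<noteq> j\<close>.\<close>

locale line_family =
  fixes u :: "'i \<Rightarrow> real^2" and c :: "'i \<Rightarrow> real"
begin

definition g :: "'i \<Rightarrow> real^2 \<Rightarrow> real"
  where "g i x = u i \<bullet> x - c i"

definition line :: "'i \<Rightarrow> (real^2) set"
  where "line i = {x. g i x = 0}"

definition cell :: "real^2 \<Rightarrow> (real^2) set"
  where "cell x = {y. \<forall>i. sgn (g i y) = sgn (g i x)}"

text \<open>This is the face order on sign vectors, as for covectors of an oriented matroid: the
  smaller vector arises by setting some entries to zero.\<close>

definition le :: "real^2 \<Rightarrow> real^2 \<Rightarrow> bool"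
  where "le x y \<longleftrightarrow> (\<forall>i. g i x = 0 \<or> sgn (g i x) = sgn (g i y))"

lemma mem_line_iff: "x \<in> line i \<longleftrightarrow> g i x = 0" by (simp add: line_def)

lemma cell_zero_iff: "y \<in> cell x \<Longrightarrow> g i y = 0 \<longleftrightarrow> g i x = 0"
  unfolding cell_def by (metis (mono_tags, lifting) mem_Collect_eq sgn_0_0)

lemma self_mem_cell: "x \<in> cell x" by (simp add: cell_def)

lemma cell_eq_iff: "cell x = cell y \<longleftrightarrow> (\<forall>i. sgn (g i x) = sgn (g i y))"
  by (auto simp: cell_def set_eq_iff)

lemma g_convex: "g i ((1 - t) *\<^sub>R x + t *\<^sub>R y) = (1 - t) * g i x + t * g i y"
  by (simp add: g_def inner_add_right algebra_simps)

lemma sgn_convex_comb: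
  fixes x y t :: real
  assumes "x = 0 \<or> sgn x = sgn y" "0 < t" "t \<le> 1"
  shows "sgn ((1 - t) * x + t * y) = sgn y"
proof -
  consider "x = 0" | "x > 0" "y > 0" | "x < 0" "y < 0"
    using assms(1) by (cases x "0::real" rule: linorder_cases) (auto simp: sgn_if split: if_splits)
  then show ?thesis
  proof cases
    case 2
    then have "(1 - t) * x + t * y > 0" using assms by (intro add_nonneg_pos) auto
    then show ?thesis using 2 by simp
  next
    case 3
    then have "(1 - t) * x + t * y < 0" using assms
      by (intro add_nonpos_neg) (auto simp: mult_nonneg_nonpos mult_pos_neg)
    then show ?thesis using 3 by simp
  qed (use assms in \<open>simp add: sgn_mult\<close>)
qed

lemma convex_cell: "convex (cell x)"
proof (rule convexI)
  fix y z and a b :: real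
  assume yz: "y \<in> cell x" "z \<in> cell x" and ab: "0 \<le> a" "0 \<le> b" "a + b = 1"
  have a: "a = 1 - b" using ab by simp
  show "a *\<^sub>R y + b *\<^sub>R z \<in> cell x"
  proof (cases "b = 0")
    case False
    then show ?thesis using yz ab unfolding cell_def a
      by (simp add: g_convex sgn_convex_comb)
  qed (use a yz in simp)
qed

text \<open>A closed half-plane that contains \<open>cell y\<close> contains its closure, so signs
  can only degenerate to zero. Conversely, on the segment from a point of \<open>cell x\<close> to
  \<open>y\<close> every point after the first lies in \<open>cell y\<close>.\<close>

lemma cell_subset_closure_cell_iff: "cell x \<subseteq> closure (cell y) \<longleftrightarrow> le x y"
proof
  assume sub: "cell x \<subseteq> closure (cell y)"
  have cont: "continuous_on UNIV (g i)" for i unfolding g_def by (intro continuous_intros)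
  have sg: "(g i z > 0 \<longleftrightarrow> g i y > 0) \<and> (g i z < 0 \<longleftrightarrow> g i y < 0)" if "z \<in> cell y" for z i
    using that unfolding cell_def
    by (metis (mono_tags, lifting) mem_Collect_eq sgn_greater sgn_less)
  have nonneg: "g i x \<ge> 0" if "g i y \<ge> 0" for i
  proof -
    have "cell y \<subseteq> {z. g i z \<ge> 0}" using sg that by (fastforce simp: not_less[symmetric])
    then have "closure (cell y) \<subseteq> {z. g i z \<ge> 0}"
      by (intro closure_minimal closed_Collect_le continuous_on_const cont)
    then show ?thesis using sub self_mem_cell by blast
  qed
  have nonpos: "g i x \<le> 0" if "g i y \<le> 0" for i
  proof -
    have "cell y \<subseteq> {z. g i z \<le> 0}" using sg that by (fastforce simp: not_less[symmetric])
    then have "closure (cell y) \<subseteq> {z. g i z \<le> 0}"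
      by (intro closure_minimal closed_Collect_le continuous_on_const cont)
    then show ?thesis using sub self_mem_cell by blast
  qed
  have "g i x = 0 \<or> sgn (g i x) = sgn (g i y)" for i
    using nonneg[of i] nonpos[of i] by (cases "g i y" "0::real" rule: linorder_cases) (auto simp: sgn_if)
  then show "le x y" by (simp add: le_def)
next
  assume le: "le x y"
  show "cell x \<subseteq> closure (cell y)"
  proof
    fix z assume z: "z \<in> cell x"
    have "(1 - t) *\<^sub>R z + t *\<^sub>R y \<in> cell y" if "0 < t" "t \<le> 1" for t
    proof -
      have "g i z = 0 \<or> sgn (g i z) = sgn (g i y)" for i
        using z le cell_zero_iff[OF z, of i] unfolding cell_def le_def by fastforce
      then show ?thesis using that by (simp add: cell_def g_convex sgn_convex_comb)
    qed
    then have ev: "eventually (\<lambda>t. (1 - t) *\<^sub>R z + t *\<^sub>R y \<in> closure (cell y)) (at_right 0)"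
      by (intro eventually_at_rightI[of 0 "1::real"]) (auto intro!: subsetD[OF closure_subset])
    have "((\<lambda>t. (1 - t) *\<^sub>R z + t *\<^sub>R y) \<longlongrightarrow> (1 - 0) *\<^sub>R z + 0 *\<^sub>R y) (at_right 0)"
      by (intro tendsto_intros)
    then show "z \<in> closure (cell y)"
      using Lim_in_closed_set[OF closed_closure ev] by simp
  qed
qed

text \<open>This makes faces and edges instances of the same sign cells. Convexity makes a cell
  connected, and by the intermediate value theorem no \<open>g i\<close> changes sign on a
  component.\<close>

lemma connected_component_set_eq_cell:
  assumes "x \<in> S" "cell x \<subseteq> S" "\<And>i. (\<forall>y\<in>S. g i y = 0) \<or> (\<forall>y\<in>S. g i y \<noteq> 0)"
  shows "connected_component_set S x = cell x"
proof
  show "cell x \<subseteq> connected_component_set S x"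
    using assms convex_connected[OF convex_cell] self_mem_cell
    by (intro connected_component_maximal) auto
  show "connected_component_set S x \<subseteq> cell x"
  proof
    fix y assume y: "y \<in> connected_component_set S x"
    let ?C = "connected_component_set S x"
    have C: "?C \<subseteq> S" "connected ?C" "x \<in> ?C"
      using assms(1) by (auto simp: connected_component_subset connected_component_refl)
    have "sgn (g i y) = sgn (g i x)" for i
    proof (cases "\<forall>y\<in>S. g i y = 0")
      case True then show ?thesis using y C by auto
    next
      case False
      then have nz: "\<forall>y\<in>?C. g i y \<noteq> 0" using assms(3) C by blast
      have "connected (g i ` ?C)"
        unfolding g_def by (intro connected_continuous_image continuous_intros C)
      then have "0 \<in> g i ` ?C" if "sgn (g i y) \<noteq> sgn (g i x)"
        using that y C(3) nz connected_contains_Icc[of "g i ` ?C" "g i y" "g i x"]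
          connected_contains_Icc[of "g i ` ?C" "g i x" "g i y"]
        by (cases "g i y" "0::real" rule: linorder_cases; cases "g i x" "0::real" rule: linorder_cases)
          (auto simp: subset_iff)
      then show ?thesis using nz by force
    qed
    then show "y \<in> cell x" by (simp add: cell_def)
  qed
qed

lemma vertices_eq: "vertices (range line) = {v. \<exists>i j. line i \<noteq> line j \<and> g i v = 0 \<and> g j v = 0}"
  by (auto simp: vertices_def line_def)

lemma faces_eq: "faces (range line) = cell ` (- \<Union>(range line))"
proof -
  have "connected_component_set (- \<Union>(range line)) x = cell x" if "x \<in> - \<Union>(range line)" for x
    using that
    by (intro connected_component_set_eq_cell) (auto simp: mem_line_iff cell_zero_iff)
  then show ?thesis by (simp add: faces_def component_set_eq)
qed

lemma edges_eq:
  "edges (range line) = cell ` (\<Union>(range line) - vertices (range line))"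
proof -
  have "connected_component_set (line k - vertices (range line)) x = cell x"
    if "x \<in> line k - vertices (range line)" for x k
  proof (rule connected_component_set_eq_cell[OF that])
    show "cell x \<subseteq> line k - vertices (range line)"
    proof
      fix y assume "y \<in> cell x"
      then show "y \<in> line k - vertices (range line)"
        using that by (auto simp: vertices_eq mem_line_iff cell_zero_iff)
    qed
    show "(\<forall>y\<in>line k - vertices (range line). g i y = 0) \<or>
        (\<forall>y\<in>line k - vertices (range line). g i y \<noteq> 0)" for i
      proof (cases "line i = line k")
      case True
      then have "g i y = 0" if "y \<in> line k" for y using that by (metis mem_line_iff)
      then show ?thesis by blast
    next
      case False
      then have "g i y \<noteq> 0" if "y \<in> line k" "y \<notin> vertices (range line)" for y
        using that unfolding vertices_eq mem_line_iff by blast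
      then show ?thesis by blast
    qed
  qed
  then have "components (line k - vertices (range line)) = cell ` (line k - vertices (range line))" for k
    by (simp add: component_set_eq)
  then show ?thesis unfolding edges_def by auto
qed

end

locale transversal_line_family = line_family +
  assumes meet: "\<And>i j x y. line i \<noteq> line j \<Longrightarrow> g i x = 0 \<Longrightarrow> g j x = 0 \<Longrightarrow>
    g i y = 0 \<Longrightarrow> g j y = 0 \<Longrightarrow> x = y"
begin

lemma cell_vertex:
  assumes "v \<in> vertices (range line)"
  shows "cell v = {v}"
proof -
  obtain i j where ij: "line i \<noteq> line j" "g i v = 0" "g j v = 0"
    using assms by (auto simp: vertices_eq)
  have "y = v" if "y \<in> cell v" for y
  proof (rule meet[OF ij(1)])
    have "sgn (g i y) = 0" "sgn (g j y) = 0" using that ij by (auto simp: cell_def)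
    then show "g i y = 0" "g j y = 0" by (auto simp: sgn_0_0)
  qed (use ij in auto)
  then show ?thesis using self_mem_cell by blast
qed

lemma vertex_mem_closure_cell_iff:
  assumes "v \<in> vertices (range line)"
  shows "v \<in> closure (cell y) \<longleftrightarrow> le v y"
  using cell_subset_closure_cell_iff[of v y] cell_vertex[OF assms] by simp

end

section \<open>Isomorphisms and unbounded edges\<close>

text \<open>A substitute for unboundedness that refers to incidences only, so that isomorphisms
  preserve it. For the tangent lines, \<open>is_ray_cell_ray_pt\<close> and \<open>is_rayE\<close>
  identify these edges with the ends of the lines.\<close>

definition is_ray :: "(real^2) set set \<Rightarrow> (real^2) set \<Rightarrow> bool"
  where "is_ray L e \<longleftrightarrow> e \<in> edges L \<and>
    (\<forall>v\<in>vertices L. \<forall>w\<in>vertices L. v \<in> closure e \<longrightarrow> w \<in> closure e \<longrightarrow> v = w)"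

definition share_face :: "(real^2) set set \<Rightarrow> (real^2) set \<Rightarrow> (real^2) set \<Rightarrow> bool"
  where "share_face L e e' \<longleftrightarrow> (\<exists>c\<in>faces L. e \<subseteq> closure c \<and> e' \<subseteq> closure c)"

definition share_vertex :: "(real^2) set set \<Rightarrow> (real^2) set \<Rightarrow> (real^2) set \<Rightarrow> bool"
  where "share_vertex L e e' \<longleftrightarrow> (\<exists>v\<in>vertices L. v \<in> closure e \<and> v \<in> closure e')"

lemma isomorphic_arrangements_sym:
  assumes "isomorphic_arrangements L M"
  shows "isomorphic_arrangements M L"
proof -
  from assms obtain f where F: "bij_betw f (all_cells L) (all_cells M) \<and>
      (\<forall>d. f ` cells L d = cells M d) \<and>
      (\<forall>c\<in>all_cells L. \<forall>c'\<in>all_cells L. c \<subseteq> closure c' \<longleftrightarrow> f c \<subseteq> closure (f c'))"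
    unfolding isomorphic_arrangements_def by (rule exE)
  have f: "bij_betw f (all_cells L) (all_cells M)" "\<And>d. f ` cells L d = cells M d"
    "\<And>c c'. c \<in> all_cells L \<Longrightarrow> c' \<in> all_cells L \<Longrightarrow>
       c \<subseteq> closure c' \<longleftrightarrow> f c \<subseteq> closure (f c')"
    using F by simp_all
  let ?h = "inv_into (all_cells L) f"
  have "bij_betw ?h (all_cells M) (all_cells L)" using f(1) by (rule bij_betw_inv_into)
  moreover have "?h ` cells M d = cells L d" for d
  proof -
    have "cells L d \<subseteq> all_cells L" by (auto simp: all_cells_def)
    then show ?thesis using f(1) unfolding f(2)[of d, symmetric] bij_betw_def
      by (intro inv_into_image_cancel) simp_all
  qed
  moreover have "c \<subseteq> closure c' \<longleftrightarrow> ?h c \<subseteq> closure (?h c')"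
    if "c \<in> all_cells M" "c' \<in> all_cells M" for c c'
  proof -
    have "?h c \<in> all_cells L" "?h c' \<in> all_cells L" "f (?h c) = c" "f (?h c') = c'"
      using that bij_betwE[OF bij_betw_inv_into[OF f(1)]] bij_betw_inv_into_right[OF f(1)]
      by simp_all
    then show ?thesis using f(3)[of "?h c" "?h c'"] by simp
  qed
  ultimately show ?thesis unfolding isomorphic_arrangements_def by (intro exI[of _ ?h]) simp
qed

lemma isomorphic_arrangements_edge_map:
  assumes "isomorphic_arrangements L M"
  obtains f where "inj_on f (edges L)"
    "\<And>e. is_ray L e \<Longrightarrow> is_ray M (f e)"
    "\<And>e e'. e \<in> edges L \<Longrightarrow> e' \<in> edges L \<Longrightarrow> share_face L e e' \<Longrightarrow> share_face M (f e) (f e')"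
    "\<And>e e'. e \<in> edges L \<Longrightarrow> e' \<in> edges L \<Longrightarrow> share_vertex M (f e) (f e') \<longleftrightarrow> share_vertex L e e'"
proof -
  from assms obtain f where F: "bij_betw f (all_cells L) (all_cells M) \<and>
      (\<forall>d. f ` cells L d = cells M d) \<and>
      (\<forall>c\<in>all_cells L. \<forall>c'\<in>all_cells L. c \<subseteq> closure c' \<longleftrightarrow> f c \<subseteq> closure (f c'))"
    unfolding isomorphic_arrangements_def by (rule exE)
  have f: "bij_betw f (all_cells L) (all_cells M)" "\<And>d. f ` cells L d = cells M d"
    "\<And>c c'. c \<in> all_cells L \<Longrightarrow> c' \<in> all_cells L \<Longrightarrow>
       c \<subseteq> closure c' \<longleftrightarrow> f c \<subseteq> closure (f c')"
    using F by simp_all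
  have all: "edges K \<subseteq> all_cells K" "faces K \<subseteq> all_cells K" "(\<lambda>v. {v}) ` vertices K \<subseteq> all_cells K" for K
  proof -
    have "cells K d \<subseteq> all_cells K" for d by (auto simp: all_cells_def)
    from this[of 1] this[of 2] this[of 0] show "edges K \<subseteq> all_cells K" "faces K \<subseteq> all_cells K"
        "(\<lambda>v. {v}) ` vertices K \<subseteq> all_cells K"
      by (simp_all add: cells_def)
  qed
  have img: "f ` edges L = edges M" "f ` faces L = faces M"
    "f ` (\<lambda>v. {v}) ` vertices L = (\<lambda>v. {v}) ` vertices M"
    using f(2)[of 1] f(2)[of 2] f(2)[of 0] by (auto simp: cells_def)
  have vert: "\<exists>w\<in>vertices M. f {v} = {w}" if "v \<in> vertices L" for v using img(3) that by blast
  have vert': "\<exists>v\<in>vertices L. f {v} = {w}" if "w \<in> vertices M" for w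
  proof -
    have "{w} \<in> f ` (\<lambda>v. {v}) ` vertices L" using img(3) that by simp
    then show ?thesis by auto
  qed
  have inc: "v \<in> closure e \<longleftrightarrow> w \<in> closure (f e)"
    if "v \<in> vertices L" "e \<in> edges L" "f {v} = {w}" for v w e
  proof -
    have "{v} \<in> all_cells L" "e \<in> all_cells L" using that all[of L] by blast+
    from f(3)[OF this] show ?thesis using that by simp
  qed
  show thesis
  proof
    show "inj_on f (edges L)" using f(1) all by (auto simp: bij_betw_def intro: inj_on_subset)
    show "is_ray M (f e)" if e: "is_ray L e" for e
      unfolding is_ray_def
    proof (intro conjI ballI impI)
      show "f e \<in> edges M" using e img(1) by (auto simp: is_ray_def)
      fix v w assume vw: "v \<in> vertices M" "w \<in> vertices M" "v \<in> closure (f e)" "w \<in> closure (f e)"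
      obtain v' w' where v': "v' \<in> vertices L" "f {v'} = {v}" and w': "w' \<in> vertices L" "f {w'} = {w}"
        using vert'[OF vw(1)] vert'[OF vw(2)] by blast
      have "e \<in> edges L" using e by (simp add: is_ray_def)
      then have "v' \<in> closure e" "w' \<in> closure e" using vw inc v' w' by blast+
      then have "v' = w'" using e v' w' by (auto simp: is_ray_def)
      then show "v = w" using v' w' by simp
    qed
    show "share_face M (f e) (f e')"
      if e: "e \<in> edges L" "e' \<in> edges L" "share_face L e e'" for e e'
    proof -
      obtain c where c: "c \<in> faces L" "e \<subseteq> closure c" "e' \<subseteq> closure c"
        using e(3) by (auto simp: share_face_def)
      have "f c \<in> faces M" using c img(2) by blast
      moreover have "c \<in> all_cells L" "e \<in> all_cells L" "e' \<in> all_cells L"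
        using c e all[of L] by blast+
      then have "f e \<subseteq> closure (f c)" "f e' \<subseteq> closure (f c)" using c f(3) by simp_all
      ultimately show ?thesis unfolding share_face_def by blast
    qed
    show "share_vertex M (f e) (f e') \<longleftrightarrow> share_vertex L e e'"
      if "e \<in> edges L" "e' \<in> edges L" for e e'
    proof
      assume "share_vertex M (f e) (f e')"
      then obtain w where w: "w \<in> vertices M" "w \<in> closure (f e)" "w \<in> closure (f e')"
        by (auto simp: share_vertex_def)
      obtain v where "v \<in> vertices L" "f {v} = {w}" using vert'[OF w(1)] by blast
      then show "share_vertex L e e'" using that w inc unfolding share_vertex_def by blast
    next
      assume "share_vertex L e e'"
      then obtain v where v: "v \<in> vertices L" "v \<in> closure e" "v \<in> closure e'"
        by (auto simp: share_vertex_def)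
      obtain w where "w \<in> vertices M" "f {v} = {w}" using vert[OF v(1)] by blast
      then show "share_vertex M (f e) (f e')" using that v inc unfolding share_vertex_def by blast
    qed
  qed
qed

section \<open>Lines tangent to the unit circle\<close>

text \<open>With angles indexed by integers, adding \<open>n\<close> is a half turn, and questions
  of parallelism become questions of divisibility by \<open>n\<close>.\<close>

definition sn :: "nat \<Rightarrow> int \<Rightarrow> real" where "sn n i = sin (of_int i * (pi / of_nat n))"
definition cs :: "nat \<Rightarrow> int \<Rightarrow> real" where "cs n i = cos (of_int i * (pi / of_nat n))"

text \<open>Applied to \<open>sn n\<close>, \<open>cs n\<close>, \<open>s\<close> and the values
  \<open>g i x\<close>, all of which change sign when the index grows by \<open>n\<close>.\<close>

lemma antiperiodic_shift:
  fixes f :: "int \<Rightarrow> real"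
  assumes "\<And>i. f (i + N) = - f i"
  shows "f (i + q * N) = (if even q then 1 else -1) * f i"
proof (induction q rule: int_induct[of _ 0])
  case (step1 q)
  then show ?case using assms[of "i + q * N"] by (auto simp: algebra_simps split: if_splits)
next
  case (step2 q)
  then show ?case using assms[of "i + (q - 1) * N"] by (auto simp: algebra_simps split: if_splits)
qed simp

lemma sn_diff: "sn n (i - j) = sn n i * cs n j - cs n i * sn n j"
  by (simp only: sn_def cs_def of_int_diff left_diff_distrib sin_diff)

lemma sn_add: "sn n (i + j) = sn n i * cs n j + cs n i * sn n j"
  by (simp only: sn_def cs_def of_int_add distrib_right sin_add)

lemma cs_diff: "cs n (i - j) = cs n i * cs n j + sn n i * sn n j"
  by (simp only: sn_def cs_def of_int_diff left_diff_distrib cos_diff)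

lemma cs_add: "cs n (i + j) = cs n i * cs n j - sn n i * sn n j"
  by (simp only: sn_def cs_def of_int_add distrib_right cos_add)

lemma sn_minus: "sn n (- i) = - sn n i" and cs_minus: "cs n (- i) = cs n i"
  by (simp_all add: sn_def cs_def)

lemma sn_0 [simp]: "sn n 0 = 0" and cs_0 [simp]: "cs n 0 = 1" by (simp_all add: sn_def cs_def)

lemma sn_cs_squared: "(sn n i)\<^sup>2 + (cs n i)\<^sup>2 = 1" by (simp add: sn_def cs_def)

lemma abs_cs_le_one: "\<bar>cs n i\<bar> \<le> 1" by (simp add: cs_def)

lemma sn_pos: "0 < m \<Longrightarrow> m < int n \<Longrightarrow> 0 < sn n m"
  unfolding sn_def by (rule sin_gt_zero) (auto simp: field_simps)

lemma sn_eq_0_iff: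
  assumes "n > 0"
  shows "sn n m = 0 \<longleftrightarrow> int n dvd m"
proof
  assume "sn n m = 0"
  then obtain k :: int where "of_int m * (pi / of_nat n) = of_int k * pi"
    by (auto simp: sn_def sin_zero_iff_int2)
  then have "real_of_int m = of_int (k * int n)" using assms by (simp add: field_simps)
  then have "m = k * int n" by (simp only: of_int_eq_iff)
  then show "int n dvd m" by simp
next
  assume "int n dvd m"
  then obtain k where "m = int n * k" ..
  then show "sn n m = 0" using assms by (auto simp: sn_def sin_zero_iff_int2 intro: exI[of _ k])
qed

lemma sn_shift: "n > 0 \<Longrightarrow> sn n (i + int n) = - sn n i"
  and cs_shift: "n > 0 \<Longrightarrow> cs n (i + int n) = - cs n i"
proof -
  assume "n > 0"
  then have "of_int (i + int n) * (pi / of_nat n) = of_int i * (pi / of_nat n) + pi"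
    by (simp add: field_simps)
  then show "sn n (i + int n) = - sn n i" "cs n (i + int n) = - cs n i"
    by (simp_all only: sn_def cs_def sin_periodic_pi cos_periodic_pi)
qed

text \<open>Reduction modulo \<open>n\<close> and the reflection of \<open>r\<close> to
  \<open>n - r\<close> bring the angle between \<open>pi / n\<close> and \<open>pi / 2\<close>,
  where the sine increases. This gap later fixes how far out a point must be for the signs to be
  those at infinity.\<close>

lemma abs_sn_ge:
  assumes "n > 0" "\<not> int n dvd m"
  shows "sn n 1 \<le> \<bar>sn n m\<bar>"
proof -
  have le_half: "sn n 1 \<le> sn n r" if "0 < r" "2 * r \<le> int n" for r
  proof -
    have "2 * real_of_int r \<le> real n" using that(2) by linarith
    then have "of_int r * (pi / real n) \<le> pi / 2" using assms(1) by (simp add: field_simps)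
    moreover have "of_int 1 * (pi / real n) \<le> of_int r * (pi / real n)"
      using that by (intro mult_right_mono) auto
    moreover have "0 \<le> of_int 1 * (pi / real n)" by simp
    ultimately show ?thesis
      unfolding sn_def using pi_gt_zero by (intro sin_monotone_2pi_le) linarith+
  qed
  define r where "r = m mod int n"
  have r: "0 < r" "r < int n"
    using assms pos_mod_sign[of "int n" m] pos_mod_bound[of "int n" m] dvd_eq_mod_eq_0[of "int n" m]
    unfolding r_def by linarith+
  have "sn n 1 \<le> sn n r"
  proof (cases "2 * r \<le> int n")
    case False
    have "sn n (int n - r) = sn n r"
      using sn_shift[OF assms(1), of "- r"] by (simp add: sn_minus)
    then show ?thesis using le_half[of "int n - r"] r False by auto
  qed (use le_half r in auto)
  moreover have "\<bar>sn n m\<bar> = \<bar>sn n r\<bar>"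
    using antiperiodic_shift[of "sn n" "int n" r "m div int n"] sn_shift[OF assms(1)]
    by (simp add: r_def abs_mult)
  ultimately show ?thesis by simp
qed

text \<open>The zeros of the sine are grid angles themselves, so there is no sign change strictly
  between two adjacent grid angles.\<close>

lemma sn_mult_sn_Suc_nonneg:
  assumes "n > 0"
  shows "0 \<le> sn n m * sn n (m + 1)"
proof -
  define r where "r = m mod int n"
  define q where "q = m div int n"
  have r: "0 \<le> r" "r < int n" using assms by (auto simp: r_def)
  have m: "m = r + q * int n" "m + 1 = (r + 1) + q * int n" by (simp_all add: r_def q_def)
  have "0 \<le> sn n r" using sn_pos[of r n] r by (cases "r = 0") auto
  moreover have "0 \<le> sn n (r + 1)"
    using sn_pos[of "r + 1" n] r sn_eq_0_iff[OF assms, of "r + 1"] by (cases "r + 1 = int n") auto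
  ultimately show ?thesis
    unfolding m(2) unfolding m(1) antiperiodic_shift[of "sn n" "int n", OF sn_shift[OF assms]]
    by auto
qed

section \<open>Unit vectors and tangents of the unit circle\<close>

definition normal :: "nat \<Rightarrow> int \<Rightarrow> real^2" where "normal n i = vector [- sn n i, cs n i]"
definition direction :: "nat \<Rightarrow> int \<Rightarrow> real^2" where "direction n i = vector [cs n i, sn n i]"

lemma inner_real2: "x \<bullet> y = x $ 1 * y $ 1 + x $ 2 * y $ 2" for x y :: "real^2"
  by (simp add: inner_vec_def sum_2)

lemma normal_inner_normal: "normal n i \<bullet> normal n j = cs n (i - j)"
  and normal_inner_direction: "normal n i \<bullet> direction n j = sn n (j - i)"
  by (simp_all add: inner_real2 normal_def direction_def cs_diff sn_diff)

lemma norm_normal: "norm (normal n i) = 1"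
  by (simp add: norm_eq_1 normal_inner_normal)

lemma normal_direction_expansion:
  "x = (x \<bullet> normal n k) *\<^sub>R normal n k + (x \<bullet> direction n k) *\<^sub>R direction n k"
proof -
  have "(x \<bullet> normal n k) * - sn n k + (x \<bullet> direction n k) * cs n k
      = x $ 1 * ((sn n k)\<^sup>2 + (cs n k)\<^sup>2)"
    "(x \<bullet> normal n k) * cs n k + (x \<bullet> direction n k) * sn n k
      = x $ 2 * ((sn n k)\<^sup>2 + (cs n k)\<^sup>2)"
    by (simp_all add: inner_real2 normal_def direction_def power2_eq_square algebra_simps)
  then show ?thesis unfolding sn_cs_squared
    by (simp add: vec_eq_iff forall_2 normal_def direction_def)
qed

text \<open>The contact points of the two tangents through \<open>x\<close> have as midpoint the
  inverse of \<open>x\<close> in the circle, so one contact point determines the other. The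
  difference \<open>a - b\<close> is orthogonal to both \<open>x\<close> and \<open>a + b\<close>,
  which are therefore parallel in the plane.\<close>

lemma unit_vectors_on_line:
  fixes a b x :: "real^2"
  assumes "norm a = 1" "norm b = 1" "x \<bullet> a = 1" "x \<bullet> b = 1" "a \<noteq> b"
  shows "(x \<bullet> x) *\<^sub>R (a + b) = 2 *\<^sub>R x"
proof -
  define z where "z = a - b"
  define y where "y = a + b"
  have zx: "z \<bullet> x = 0" using assms by (simp add: z_def inner_diff_left inner_diff_right inner_commute)
  have zy: "z \<bullet> y = 0" using assms
    by (simp add: z_def y_def inner_diff_left inner_diff_right inner_add_right inner_commute norm_eq_1)
  have xy: "x \<bullet> y = 2" using assms by (simp add: y_def inner_add_right)
  have "z \<noteq> 0" using assms by (simp add: z_def)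
  have "z $ 1 * (y $ 1 * x $ 2 - y $ 2 * x $ 1) = 0" "z $ 2 * (y $ 1 * x $ 2 - y $ 2 * x $ 1) = 0"
    using zx zy unfolding inner_real2 by algebra+
  then have "y $ 1 * x $ 2 = y $ 2 * x $ 1"
    using \<open>z \<noteq> 0\<close> by (auto simp: vec_eq_iff forall_2)
  then have "(x \<bullet> x) * y $ 1 = 2 * x $ 1" "(x \<bullet> x) * y $ 2 = 2 * x $ 2"
    using xy unfolding inner_real2 by algebra+
  then show ?thesis by (simp add: vec_eq_iff forall_2 y_def)
qed

lemma three_unit_vectors_on_line:
  fixes a b c x :: "real^2"
  assumes "norm a = 1" "norm b = 1" "norm c = 1" "x \<bullet> a = 1" "x \<bullet> b = 1" "x \<bullet> c = 1"
  shows "a = b \<or> b = c \<or> a = c"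
proof (rule ccontr)
  assume neq: "\<not> ?thesis"
  then have "(x \<bullet> x) *\<^sub>R (a + b) = (x \<bullet> x) *\<^sub>R (a + c)"
    using unit_vectors_on_line[of a b x] unit_vectors_on_line[of a c x] assms by simp
  moreover have "x \<noteq> 0" using assms by auto
  ultimately show False using neq by simp
qed

text \<open>The cross product in the plane, positive when \<open>b\<close> follows \<open>a\<close>
  counterclockwise by less than a half turn.\<close>

definition cr :: "real^2 \<Rightarrow> real^2 \<Rightarrow> real"
  where "cr a b = a $ 1 * b $ 2 - a $ 2 * b $ 1"

lemma cr_commute: "cr b a = - cr a b" by (simp add: cr_def)

text \<open>From a point \<open>x\<close> on the tangent at \<open>a\<close>, the circle is visible
  only on the side of \<open>a\<close> on which \<open>x\<close> lies. In the expansion of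
  \<open>x \<bullet> b\<close> along \<open>a\<close> and its perpendicular, the first summand is at
  most 1, so the second is positive.\<close>

lemma tangent_side:
  assumes "norm a = 1" "norm b = 1" "x \<bullet> a = 1" "x \<bullet> b > 1"
  shows "cr a x * cr a b > 0"
proof -
  have "(x \<bullet> b) * (a \<bullet> a) = (x \<bullet> a) * (a \<bullet> b) + cr a x * cr a b"
    by (simp add: inner_real2 cr_def algebra_simps)
  moreover have "a \<bullet> a = 1" using assms by (simp add: norm_eq_1)
  moreover have "a \<bullet> b \<le> 1" using norm_cauchy_schwarz[of a b] assms by simp
  ultimately show ?thesis using assms by simp
qed

text \<open>The visible part of the circle is an arc. A point \<open>b\<close> between
  \<open>a\<close> and \<open>c\<close> is a positive combination of them, and the triangle
  inequality makes the sum of the coefficients at least 1.\<close>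

lemma tangent_between:
  assumes "norm a = 1" "norm b = 1" "norm c = 1" "cr a b > 0" "cr b c > 0" "cr a c > 0"
    and "x \<bullet> a \<ge> 1" "x \<bullet> c \<ge> 1"
  shows "x \<bullet> b \<ge> 1"
proof -
  have eq: "cr a c *\<^sub>R b = cr b c *\<^sub>R a + cr a b *\<^sub>R c"
    by (simp add: vec_eq_iff forall_2 cr_def algebra_simps)
  have "cr a c = norm (cr a c *\<^sub>R b)" using assms by simp
  also have "\<dots> \<le> norm (cr b c *\<^sub>R a) + norm (cr a b *\<^sub>R c)"
    unfolding eq by (rule norm_triangle_ineq)
  finally have "cr a c \<le> cr b c + cr a b" using assms by simp
  also have "\<dots> \<le> cr b c * (x \<bullet> a) + cr a b * (x \<bullet> c)"
    using assms by (intro add_mono) simp_all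
  also have "\<dots> = x \<bullet> (cr b c *\<^sub>R a + cr a b *\<^sub>R c)" by (simp add: inner_add_right)
  also have "\<dots> = cr a c * (x \<bullet> b)" by (simp flip: eq)
  finally show ?thesis using assms by simp
qed

text \<open>The \<open>n\<close> lines are tangent to the unit circle at the points \<open>s i *\<^sub>R normal n i\<close>. The indices \<open>i\<close> and
  \<open>i + n\<close> denote the same line with opposite normal vectors, so that all rotations of the
  arrangement look alike. The prescribed values \<open>s 0\<close>, \<open>s 1\<close>, \<open>s 2\<close> prevent the tangent points
  from lying in a half circle; this makes the central cell bounded.\<close>

locale tangent_lines =
  fixes n :: nat and s :: "int \<Rightarrow> real"
  assumes n: "n \<ge> 5"
    and s_cases: "\<And>i. s i = 1 \<or> s i = -1"
    and s_shift: "\<And>i. s (i + int n) = - s i"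
    and s012: "s 0 = 1" "s 1 = -1" "s 2 = 1"
begin

sublocale line_family "normal n" s .

lemma n_pos: "n > 0" using n by simp

lemma g_shift: "g (i + int n) x = - g i x"
proof -
  have "normal n (i + int n) = - normal n i"
    by (simp add: normal_def vec_eq_iff forall_2 sn_shift cs_shift n_pos)
  then show ?thesis by (simp add: g_def s_shift)
qed

lemma g_shift_mult: "g (i + q * int n) x = (if even q then 1 else -1) * g i x"
  using antiperiodic_shift[of "\<lambda>i. g i x" "int n"] g_shift by blast

lemma g_zero_cong: "int n dvd i - j \<Longrightarrow> g i x = 0 \<longleftrightarrow> g j x = 0"
proof -
  assume "int n dvd i - j"
  then obtain q where "i = j + q * int n" by (metis dvdE mult.commute add.commute diff_add_cancel)
  then show ?thesis by (simp add: g_shift_mult)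
qed

section \<open>Incidences of the tangent lines\<close>

definition pt :: "int \<Rightarrow> real \<Rightarrow> real^2"
  where "pt k t = s k *\<^sub>R normal n k + t *\<^sub>R direction n k"

lemma g_pt: "g i (pt k t) = s k * cs n (i - k) + t * sn n (k - i) - s i"
  by (simp add: g_def pt_def inner_add_right normal_inner_normal normal_inner_direction)

lemma g_pt_self [simp]: "g k (pt k t) = 0" by (simp add: g_pt)

lemma pt_of_line:
  assumes "g k x = 0"
  shows "x = pt k (x \<bullet> direction n k)"
  using normal_direction_expansion[of x n k] assms by (simp add: g_def pt_def inner_commute)

lemma line_eq_iff: "line i = line j \<longleftrightarrow> int n dvd i - j"
proof
  assume "line i = line j"
  then have "g i (pt j 0) = 0" "g i (pt j 1) = 0" by (metis g_pt_self mem_line_iff)+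
  then have "sn n (j - i) = 0" by (simp add: g_pt)
  then show "int n dvd i - j" by (simp add: sn_eq_0_iff n_pos dvd_diff_commute)
qed (auto simp: set_eq_iff mem_line_iff g_zero_cong)

sublocale transversal_line_family "normal n" s
proof
  fix i j x y
  assume "line i \<noteq> line j" and x: "g i x = 0" "g j x = 0" and y: "g i y = 0" "g j y = 0"
  then have "sn n (i - j) \<noteq> 0" by (simp add: line_eq_iff sn_eq_0_iff n_pos)
  moreover have "g j (pt i (x \<bullet> direction n i)) = 0" "g j (pt i (y \<bullet> direction n i)) = 0"
    using x y pt_of_line by metis+
  moreover from this have "(x \<bullet> direction n i) * sn n (i - j) = (y \<bullet> direction n i) * sn n (i - j)"
    unfolding g_pt by linarith
  ultimately have "x \<bullet> direction n i = y \<bullet> direction n i" by simp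
  then show "x = y" using pt_of_line x y by metis
qed

abbreviation Lines :: "(real^2) set set" where "Lines \<equiv> range line"

lemma mem_vertices_iff:
  "v \<in> vertices Lines \<longleftrightarrow> (\<exists>i j. \<not> int n dvd i - j \<and> g i v = 0 \<and> g j v = 0)"
  by (auto simp: vertices_eq line_eq_iff)

lemma mem_edge_points_iff:
  "x \<in> \<Union>Lines - vertices Lines \<longleftrightarrow> (\<exists>k. \<forall>i. g i x = 0 \<longleftrightarrow> int n dvd i - k)"
proof
  assume x: "x \<in> \<Union>Lines - vertices Lines"
  then obtain k where "g k x = 0" by (auto simp: mem_line_iff)
  then have "g i x = 0 \<longleftrightarrow> int n dvd i - k" for i
    using x g_zero_cong[of i k] by (auto simp: mem_vertices_iff)
  then show "\<exists>k. \<forall>i. g i x = 0 \<longleftrightarrow> int n dvd i - k" by blast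
next
  assume "\<exists>k. \<forall>i. g i x = 0 \<longleftrightarrow> int n dvd i - k"
  then obtain k where k: "\<And>i. g i x = 0 \<longleftrightarrow> int n dvd i - k" by blast
  then have "x \<in> line k" by (simp add: mem_line_iff)
  moreover have "x \<notin> vertices Lines"
  proof
    assume "x \<in> vertices Lines"
    then obtain i j where ij: "\<not> int n dvd i - j" "int n dvd i - k" "int n dvd j - k"
      unfolding mem_vertices_iff k by blast
    from dvd_diff[OF ij(2,3)] ij(1) show False by simp
  qed
  ultimately show "x \<in> \<Union>Lines - vertices Lines" by blast
qed

lemma mem_face_points_iff: "x \<in> - \<Union>Lines \<longleftrightarrow> (\<forall>i. g i x \<noteq> 0)"
  by (auto simp: mem_line_iff)

lemma Lines_eq: "Lines = line ` {0..<int n}"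
proof
  show "Lines \<subseteq> line ` {0..<int n}"
  proof
    fix l assume "l \<in> Lines"
    then obtain i where "l = line i" by blast
    then have "l = line (i mod int n)" by (simp add: line_eq_iff minus_mod_eq_mult_div)
    then show "l \<in> line ` {0..<int n}" using n_pos by auto
  qed
qed blast

lemma eq_of_dvd_diff:
  assumes "i \<in> {0..<int n}" "j \<in> {0..<int n}" "int n dvd i - j"
  shows "i = j"
proof -
  have "i mod int n = j mod int n" using assms(3) by (simp add: mod_eq_dvd_iff)
  then show "i = j" using assms by simp
qed

lemma card_Lines: "card Lines = n"
proof -
  have "inj_on line {0..<int n}"
  proof (rule inj_onI)
    fix i j assume ij: "i \<in> {0..<int n}" "j \<in> {0..<int n}" "line i = line j"
    then have "int n dvd i - j" by (simp add: line_eq_iff)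
    then show "i = j" using ij eq_of_dvd_diff by blast
  qed
  then show ?thesis unfolding Lines_eq by (simp add: card_image)
qed

subsection \<open>The central cell and its complement\<close>

definition p :: "int \<Rightarrow> real^2" where "p k = s k *\<^sub>R normal n k"

lemma s_square: "s i * s i = 1" using s_cases[of i] by auto

lemma norm_p: "norm (p k) = 1"
  using s_cases[of k] by (auto simp: p_def norm_normal)

text \<open>\<open>x \<bullet> p k > 1\<close> says that the tangent at \<open>p k\<close> separates
  \<open>x\<close> from the circle, independently of the orientation of the normal. The sign
  \<open>s k\<close> converts between the two descriptions.\<close>

lemma g_eq: "g k x = s k * (x \<bullet> p k - 1)"
  by (simp add: g_def p_def inner_commute algebra_simps s_square flip: mult.assoc)

lemma cr_p: "cr (p i) (p j) = s i * s j * sn n (j - i)"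
  by (simp add: cr_def p_def normal_def sn_diff algebra_simps)

lemma cr_p_neq_0: "\<not> int n dvd i - j \<Longrightarrow> cr (p i) (p j) \<noteq> 0"
  using s_cases[of i] s_cases[of j] by (auto simp: cr_p sn_eq_0_iff n_pos dvd_diff_commute)

lemma p_eq_imp_dvd: "p i = p j \<Longrightarrow> int n dvd i - j"
  using cr_p_neq_0[of i j] by (auto simp: cr_def)

lemma p_cong:
  assumes "int n dvd i - j"
  shows "p i = p j"
proof -
  obtain q where "i = j + q * int n"
    using assms by (metis dvdE mult.commute add.commute diff_add_cancel)
  then show ?thesis
    using antiperiodic_shift[of s, OF s_shift] antiperiodic_shift[of "sn n", OF sn_shift[OF n_pos]]
      antiperiodic_shift[of "cs n", OF cs_shift[OF n_pos]]
    by (simp add: p_def normal_def vec_eq_iff forall_2)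
qed

lemma g_zero_iff: "g k x = 0 \<longleftrightarrow> x \<bullet> p k = 1"
  using s_cases[of k] by (auto simp: g_eq)

lemma three_lines:
  assumes "g i x = 0" "g j x = 0" "g k x = 0"
  shows "int n dvd i - j \<or> int n dvd j - k \<or> int n dvd i - k"
  using three_unit_vectors_on_line[OF norm_p norm_p norm_p, of x i j k] p_eq_imp_dvd assms
  unfolding g_zero_iff by blast

lemma le_iff: "le x y \<longleftrightarrow> (\<forall>i. x \<bullet> p i = 1 \<or> sgn (x \<bullet> p i - 1) = sgn (y \<bullet> p i - 1))"
proof -
  have "sgn (g i x) = sgn (g i y) \<longleftrightarrow> sgn (x \<bullet> p i - 1) = sgn (y \<bullet> p i - 1)" for i
    using s_cases[of i] unfolding g_eq sgn_mult by auto
  then show ?thesis by (simp add: le_def g_zero_iff)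
qed

lemma simple_euclidean_arrangement_Lines: "simple_euclidean_arrangement Lines"
proof -
  \<comment> \<open>Homogeneous coefficients of the lines: the inner product of \<open>N i\<close>
    with the vector of coordinates \<open>x $ 1\<close>, \<open>x $ 2\<close>, \<open>1\<close> is
    \<open>g i x\<close>.\<close>
  define N :: "int \<Rightarrow> real^3" where "N i = vector [- sn n i, cs n i, - s i]" for i
  let ?A = "N ` {0..<int n}"
  have comp: "N i $ 1 = - sn n i" "N i $ 2 = cs n i" "N i $ 3 = - s i" for i
    by (simp_all add: N_def)
  have N_inner: "N i \<bullet> v = normal n i \<bullet> vector [v $ 1, v $ 2] - s i * v $ 3" for i v
    by (simp add: inner_vec_def sum_2 sum_3 comp normal_def)
  have planar: "N i $ 1 \<noteq> 0 \<or> N i $ 2 \<noteq> 0" for i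
    using sn_cs_squared[of n i] unfolding comp by auto
  have cross: "cross3 (N i) (N j) \<noteq> 0" if "\<not> int n dvd i - j" for i j
  proof -
    have "cross3 (N i) (N j) $ 3 = sn n (j - i)" by (simp add: cross3_def comp sn_diff)
    then show ?thesis using that
      by (metis dvd_diff_commute n_pos sn_eq_0_iff zero_index)
  qed
  have cross_axis: "cross3 (axis 3 1) (N i) \<noteq> 0" "cross3 (N i) (axis 3 1) \<noteq> 0" for i
    using planar[of i] by (auto simp: cross3_def vec_eq_iff forall_3 axis_def)
  have apart: "\<not> int n dvd i - j" if "i \<in> {0..<int n}" "j \<in> {0..<int n}" "N i \<noteq> N j" for i j
    using eq_of_dvd_diff that by auto
  \<comment> \<open>No two lines meet at infinity, since their directions differ. In
    \<open>triple\<close> this permits division by the third coordinate and reduces the claim to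
    \<open>three_lines\<close>.\<close>
  have parallel: "v $ 3 \<noteq> 0"
    if v: "v \<noteq> 0" "a \<in> ?A" "b \<in> ?A" "a \<noteq> b" "a \<bullet> v = 0" "b \<bullet> v = 0" for a b v
  proof
    assume v3: "v $ 3 = 0"
    obtain i j where ij: "a = N i" "b = N j" "\<not> int n dvd i - j" using v(2-4) apart by blast
    define w :: "real^2" where "w = vector [v $ 1, v $ 2]"
    have w: "w $ 1 = v $ 1" "w $ 2 = v $ 2" by (simp_all add: w_def)
    have 1: "normal n i \<bullet> w = 0" "normal n j \<bullet> w = 0"
      using v ij v3 by (auto simp: N_inner w_def)
    have wd: "w = (w \<bullet> direction n i) *\<^sub>R direction n i"
      using normal_direction_expansion[of w n i] 1 by (simp add: inner_commute)
    then have "0 = (w \<bullet> direction n i) * sn n (i - j)"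
      using 1(2) normal_inner_direction[of n j i] by (metis inner_scaleR_right)
    then have "w \<bullet> direction n i = 0" using ij(3) by (simp add: sn_eq_0_iff n_pos)
    then have "w = 0" using wd by simp
    then show False using v(1) v3 w by (simp add: vec_eq_iff forall_3)
  qed
  have triple: False
    if v: "v \<noteq> 0" "a \<in> ?A" "b \<in> ?A" "c \<in> ?A" "a \<bullet> v = 0" "b \<bullet> v = 0" "c \<bullet> v = 0"
      and ne: "a \<noteq> b" "b \<noteq> c" "a \<noteq> c" for a b c v
  proof -
    obtain i j k where ijk: "a = N i" "b = N j" "c = N k"
      "\<not> int n dvd i - j" "\<not> int n dvd j - k" "\<not> int n dvd i - k"
      using v ne apart by blast
    have v3: "v $ 3 \<noteq> 0" using parallel[OF v(1-3) ne(1) v(5,6)] .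
    define x :: "real^2" where "x = vector [v $ 1, v $ 2] /\<^sub>R v $ 3"
    have "g m x = (N m \<bullet> v) / v $ 3" for m
      using v3 by (simp add: g_def x_def N_inner field_simps)
    then show False using three_lines[of i x j k] ijk v by simp
  qed
  have "simple_euclidean_arrangement
      ((\<lambda>a. {x. a $ 1 * x $ 1 + a $ 2 * x $ 2 + a $ 3 = 0}) ` ?A)"
  proof (rule simple_euclidean_arrangement_lines)
    have ax: "(axis 3 1 :: real^3) $ 1 = 0" "(axis 3 1 :: real^3) $ 2 = 0"
      by (simp_all add: axis_def)
    then show "axis 3 1 \<notin> ?A" using planar by (metis imageE)
    show "cross3 a b \<noteq> 0" if "a \<in> insert (axis 3 1) ?A" "b \<in> insert (axis 3 1) ?A" "a \<noteq> b" for a b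
      using that apart cross cross_axis by blast
    show "a \<noteq> 0" if "a \<in> insert (axis 3 1) ?A" for a
      using that planar by (auto simp: axis_eq_0_iff) (metis zero_index)
    show "card {a \<in> insert (axis 3 1) ?A. a \<bullet> v = 0} \<le> 2" if v: "v \<noteq> 0" for v
    proof (rule ccontr)
      assume "\<not> ?thesis"
      then have "3 \<le> card {a \<in> insert (axis 3 1) ?A. a \<bullet> v = 0}" by simp
      then obtain T where T: "T \<subseteq> {a \<in> insert (axis 3 1) ?A. a \<bullet> v = 0}" "card T = 3"
        by (rule obtain_subset_with_card_n)
      then obtain a b c where abc: "T = {a, b, c}" "a \<noteq> b" "b \<noteq> c" "a \<noteq> c"
        by (auto simp: card_3_iff)
      have zero: "a \<bullet> v = 0" "b \<bullet> v = 0" "c \<bullet> v = 0" using T abc by auto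
      have mem: "a = axis 3 1 \<or> a \<in> ?A" "b = axis 3 1 \<or> b \<in> ?A" "c = axis 3 1 \<or> c \<in> ?A"
        using T abc by auto
      have ax: "(axis 3 1 :: real^3) \<bullet> v = v $ 3" by (simp add: inner_axis')
      show False
        using mem abc(2-4) zero ax triple[OF v, of a b c]
          parallel[OF v, of a b] parallel[OF v, of b c] parallel[OF v, of a c] by metis
    qed
  qed simp
  also have "(\<lambda>a. {x. a $ 1 * x $ 1 + a $ 2 * x $ 2 + a $ 3 = 0}) ` ?A = Lines"
    unfolding Lines_eq image_image line_def g_def comp
    by (simp add: inner_real2 normal_def)
  finally show ?thesis .
qed

lemma edges_of_cell:
  "edges_of Lines (cell y) = cell ` {x. (\<exists>k. \<forall>i. g i x = 0 \<longleftrightarrow> int n dvd i - k) \<and> le x y}"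
  using cell_subset_closure_cell_iff
  unfolding edges_of_def edges_eq mem_edge_points_iff[symmetric] by blast

lemma cell_eq_of_le:
  assumes "\<And>i. g i x = 0 \<longleftrightarrow> int n dvd i - k" "\<And>i. g i x' = 0 \<longleftrightarrow> int n dvd i - k"
    and "le x y" "le x' y"
  shows "cell x = cell x'"
  using assms unfolding cell_eq_iff le_def by (metis sgn_0_0)

text \<open>On an edge of the face one endpoint of the visible arc reaches a tangent point. That
  point is either leaving or entering the arc, at one of its two endpoints, which gives four
  possibilities.\<close>

lemma card_edges_of_noncentral:
  assumes y: "\<And>i. g i y \<noteq> 0" and m: "y \<bullet> p m > 1"
  shows "card (edges_of Lines (cell y)) \<le> 4"
proof -
  let ?E = "edges_of Lines (cell y)"
  have "\<exists>x k. e = cell x \<and> (\<forall>i. g i x = 0 \<longleftrightarrow> int n dvd i - k) \<and> le x y" if "e \<in> ?E" for e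
    using that unfolding edges_of_cell by blast
  then obtain X K where XK: "\<And>e. e \<in> ?E \<Longrightarrow> e = cell (X e)"
    "\<And>e i. e \<in> ?E \<Longrightarrow> g i (X e) = 0 \<longleftrightarrow> int n dvd i - K e" "\<And>e. e \<in> ?E \<Longrightarrow> le (X e) y"
    by metis
  \<comment> \<open>An edge is determined by whether its line separates the face from the circle and on which side
    of the tangent point it lies.\<close>
  define \<phi> where "\<phi> e = (y \<bullet> p (K e) > 1, cr (p (K e)) (X e) > 0)" for e
  have "inj_on \<phi> ?E"
  proof (rule inj_onI)
    fix e e' assume e: "e \<in> ?E" and e': "e' \<in> ?E" and eq: "\<phi> e = \<phi> e'"
    define a where "a = p (K e)"
    define a' where "a' = p (K e')"
    define x where "x = X e"
    define x' where "x' = X e'"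
    have na: "norm a = 1" "norm a' = 1" by (simp_all add: a_def a'_def norm_p)
    show "e = e'"
    proof (cases "int n dvd K e - K e'")
      case True
      have "int n dvd i - K e \<longleftrightarrow> int n dvd i - K e'" for i
        using dvd_add_left_iff[OF True, of "i - K e"] by simp
      then have "cell (X e) = cell (X e')"
        using XK e e' by (intro cell_eq_of_le[of _ "K e"]) auto
      then show ?thesis using XK e e' by metis
    next
      case False
      have one: "x \<bullet> a = 1" "x' \<bullet> a' = 1"
        using XK(2)[OF e, of "K e"] XK(2)[OF e', of "K e'"]
        by (simp_all add: a_def a'_def x_def x'_def g_zero_iff)
      have sg: "sgn (X e \<bullet> p i - 1) = sgn (y \<bullet> p i - 1)" if "\<not> int n dvd i - K e" "e \<in> ?E" for i e
        using XK(2,3)[OF that(2)] that(1) unfolding le_iff g_zero_iff by metis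
      have sg1: "sgn (x \<bullet> a' - 1) = sgn (y \<bullet> a' - 1)" "sgn (x' \<bullet> a - 1) = sgn (y \<bullet> a - 1)"
        using sg[of "K e'" e] sg[of "K e" e'] e e' False
        by (simp_all add: a_def a'_def x_def x'_def dvd_diff_commute)
      have K: "cr a a' \<noteq> 0" using cr_p_neq_0[OF False] by (simp add: a_def a'_def)
      have side: "cr a x > 0 \<longleftrightarrow> cr a' x' > 0" and inS: "y \<bullet> a > 1 \<longleftrightarrow> y \<bullet> a' > 1"
        using eq by (auto simp: \<phi>_def a_def a'_def x_def x'_def)
      have False
      proof (cases "y \<bullet> a > 1")
        \<comment> \<open>Both contact points are visible from the face, so \<open>x\<close> is
          beyond the tangent at \<open>a'\<close> and \<open>x'\<close> is beyond the tangent at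
          \<open>a\<close>. By \<open>tangent_side\<close>, \<open>a'\<close> lies on the side of
          \<open>a\<close> given by \<open>x\<close>, and \<open>a\<close> on the side of
          \<open>a'\<close> given by \<open>x'\<close>. These sides agree, contrary to the
          antisymmetry of \<open>cr\<close>.\<close>
        case True
        then have "x \<bullet> a' > 1" "x' \<bullet> a > 1"
          using sg1 inS by (auto simp: sgn_1_pos)
        then have "cr a x * cr a a' > 0" "cr a' x' * cr a' a > 0"
          using tangent_side na one by blast+
        then show False using side cr_commute[of a' a] by (auto simp: zero_less_mult_iff mult_less_0_iff)
      next
        case False
        have ny: "y \<bullet> a < 1" "y \<bullet> a' < 1"
          using False inS y[of "K e"] y[of "K e'"] unfolding g_zero_iff a_def a'_def by linarith+
        then have lt: "x \<bullet> a' < 1" "x' \<bullet> a < 1" using sg1 by (auto simp: sgn_1_neg)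
        \<comment> \<open>Neither contact point is visible from the face, but \<open>c\<close> is.
          It lies on the same side of \<open>a\<close> and of \<open>a'\<close>, so one of these two
          is between the other and \<open>c\<close>, and \<open>tangent_between\<close> would make
          it visible. The four cases are the two sides and the two orders.\<close>
        define c where "c = p m"
        have nc: "norm c = 1" by (simp add: c_def norm_p)
        have "\<not> int n dvd m - K e" "\<not> int n dvd m - K e'"
          using p_cong[of m "K e"] p_cong[of m "K e'"] m ny by (auto simp: a_def a'_def)
        then have gt: "x \<bullet> c > 1" "x' \<bullet> c > 1"
          using sg[of m e] sg[of m e'] e e' m by (auto simp: x_def x'_def c_def sgn_1_pos)
        have c: "cr a x * cr a c > 0" "cr a' x' * cr a' c > 0"
          using tangent_side na nc one gt by blast+
        consider "cr a c > 0" "cr a' c > 0" "cr a a' > 0" | "cr a c > 0" "cr a' c > 0" "cr a a' < 0"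
          | "cr a c < 0" "cr a' c < 0" "cr a a' > 0" | "cr a c < 0" "cr a' c < 0" "cr a a' < 0"
          using c side K by (auto simp: zero_less_mult_iff) linarith+
        then show False
        proof cases
          case 1
          then have "x \<bullet> a' \<ge> 1" using tangent_between[of a a' c x] na nc one gt by simp
          then show False using lt by simp
        next
          case 2
          then have "x' \<bullet> a \<ge> 1" using tangent_between[of a' a c x'] na nc one gt cr_commute[of a' a] by simp
          then show False using lt by simp
        next
          case 3
          then have "x' \<bullet> a \<ge> 1" using tangent_between[of c a a' x'] na nc one gt
              cr_commute[of c a] cr_commute[of c a'] by simp
          then show False using lt by simp
        next
          case 4
          then have "x \<bullet> a' \<ge> 1" using tangent_between[of c a' a x] na nc one gt
              cr_commute[of c a] cr_commute[of c a'] cr_commute[of a' a] by simp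
          then show False using lt by simp
        qed
      qed
      then show ?thesis ..
    qed
  qed
  then have "card ?E \<le> card (UNIV :: (bool \<times> bool) set)"
    by (intro card_inj_on_le[of \<phi>]) auto
  also have "\<dots> = 4" by (simp add: card_UNIV_bool flip: UNIV_Times_UNIV)
  finally show ?thesis .
qed

lemma p_inner_p: "\<not> int n dvd i - j \<Longrightarrow> p i \<bullet> p j < 1"
proof -
  assume nd: "\<not> int n dvd i - j"
  have "p i \<bullet> p j \<le> 1" using norm_cauchy_schwarz[of "p i" "p j"] by (simp add: norm_p)
  moreover have "p i \<bullet> p j \<noteq> 1"
  proof
    assume "p i \<bullet> p j = 1"
    moreover have "p i \<bullet> p i = 1" "p j \<bullet> p j = 1" using norm_p unfolding norm_eq_1 by auto
    ultimately have "(p i - p j) \<bullet> (p i - p j) = 0"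
      by (simp add: inner_diff_left inner_diff_right inner_commute)
    then have "p i = p j" by simp
    then show False using p_eq_imp_dvd nd by blast
  qed
  ultimately show ?thesis by simp
qed

lemma p_inner_p_self: "int n dvd i - j \<Longrightarrow> p i \<bullet> p j = 1"
  using p_cong[of i j] norm_p[of j] unfolding norm_eq_1 by simp

lemma g_p_zero_iff: "g i (p k) = 0 \<longleftrightarrow> int n dvd i - k"
  unfolding g_zero_iff using p_inner_p[of k i] p_inner_p_self[of k i]
  by (metis dvd_diff_commute less_irrefl)

lemma le_p_zero: "le (p k) 0"
  unfolding le_iff
proof
  fix i
  show "p k \<bullet> p i = 1 \<or> sgn (p k \<bullet> p i - 1) = sgn (0 \<bullet> p i - 1)"
    using p_inner_p[of k i] p_inner_p_self[of k i] by (cases "int n dvd k - i") simp_all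
qed

lemma edges_of_center: "edges_of Lines (cell 0) = (\<lambda>k. cell (p k)) ` {0..<int n}"
proof
  show "(\<lambda>k. cell (p k)) ` {0..<int n} \<subseteq> edges_of Lines (cell 0)"
    using g_p_zero_iff le_p_zero unfolding edges_of_cell by blast
  show "edges_of Lines (cell 0) \<subseteq> (\<lambda>k. cell (p k)) ` {0..<int n}"
  proof
    fix e assume "e \<in> edges_of Lines (cell 0)"
    then obtain x k where x: "e = cell x" "\<And>i. g i x = 0 \<longleftrightarrow> int n dvd i - k" "le x 0"
      unfolding edges_of_cell by blast
    have "cell x = cell (p k)"
      using cell_eq_of_le[of x k "p k" 0] x le_p_zero g_p_zero_iff by blast
    also have "p k = p (k mod int n)"
      by (intro p_cong) (simp add: minus_mod_eq_mult_div)
    finally show "e \<in> (\<lambda>k. cell (p k)) ` {0..<int n}" using x(1) n_pos by auto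
  qed
qed

lemma card_edges_of_center: "card (edges_of Lines (cell 0)) = n"
proof -
  have "inj_on (\<lambda>k. cell (p k)) {0..<int n}"
  proof (rule inj_onI)
    fix i j assume ij: "i \<in> {0..<int n}" "j \<in> {0..<int n}" "cell (p i) = cell (p j)"
    then have "g i (p j) = 0" using g_p_zero_iff[of i i] unfolding cell_eq_iff
      by (metis diff_self dvd_0_right sgn_0_0)
    then show "i = j" using ij eq_of_dvd_diff g_p_zero_iff by blast
  qed
  then show ?thesis unfolding edges_of_center by (simp add: card_image)
qed

text \<open>The sum of \<open>normal n 0\<close> and \<open>normal n 2\<close> is a nonnegative
  multiple of \<open>normal n 1\<close>. With the signs of the tangents 0, 1, 2 this bounds
  \<open>A + C\<close> below by -2, while \<open>A\<close> and \<open>C\<close> are below 1; hence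
  both are at least -3.\<close>

lemma bounded_center: "bounded (cell 0)"
proof -
  \<comment> \<open>The summand 3 bounds \<open>\<bar>y $ 2\<bar> = \<bar>A\<bar>\<close>, and
    \<open>6 / sn n 2\<close> bounds \<open>\<bar>y $ 1\<bar>\<close>, which is recovered from
    \<open>cs n 2 * A - C\<close>.\<close>
  have "norm y \<le> 3 + 6 / sn n 2" if y: "y \<in> cell 0" for y
  proof -
    have lt: "y \<bullet> p i < 1" for i
    proof -
      have "sgn (g i y) = sgn (g i 0)" using y by (simp add: cell_def)
      then show ?thesis using s_cases[of i] by (auto simp: g_eq sgn_1_pos sgn_1_neg)
    qed
    define A where "A = y \<bullet> normal n 0"
    define B where "B = y \<bullet> normal n 1"
    define C where "C = y \<bullet> normal n 2"
    have ABC: "A < 1" "- B < 1" "C < 1"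
      using lt[of 0] lt[of 1] lt[of 2] by (simp_all add: p_def s012 A_def B_def C_def)
    have "cs n (1 - (-1)) + 1 = 2 * cs n 1 * cs n 1"
      unfolding cs_diff cs_minus sn_minus using sn_cs_squared[of n 1] by (simp add: power2_eq_square)
    moreover have "sn n (1 - (-1)) = 2 * sn n 1 * cs n 1"
      unfolding sn_diff cs_minus sn_minus by simp
    ultimately have double: "cs n 2 + 1 = 2 * cs n 1 * cs n 1" "sn n 2 = 2 * sn n 1 * cs n 1"
      by simp_all
    have "A + C = - (y $ 1 * sn n 2) + y $ 2 * (cs n 2 + 1)"
      by (simp add: A_def C_def inner_real2 normal_def algebra_simps)
    also have "\<dots> = 2 * cs n 1 * B"
      unfolding double by (simp add: B_def inner_real2 normal_def algebra_simps)
    finally have AC: "A + C = 2 * cs n 1 * B" .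
    have "pi / real n \<le> pi / 2" using n by (intro divide_left_mono) auto
    moreover have "- (pi / 2) \<le> pi / real n" by (rule order_trans[of _ 0]) simp_all
    ultimately have c1: "0 \<le> cs n 1" "cs n 1 \<le> 1"
      by (simp_all add: cs_def cos_ge_zero)
    have "cs n 1 * B \<ge> cs n 1 * (-1)" using ABC c1 by (intro mult_left_mono) auto
    then have "A + C \<ge> -2" using AC c1 by linarith
    then have abs: "\<bar>A\<bar> \<le> 3" "\<bar>C\<bar> \<le> 3" using ABC by linarith+
    have s2: "sn n 2 > 0" using n by (intro sn_pos) auto
    have A: "A = y $ 2" by (simp add: A_def inner_real2 normal_def)
    have "sn n 2 * y $ 1 = cs n 2 * A - C" by (simp add: A C_def inner_real2 normal_def)
    then have "sn n 2 * \<bar>y $ 1\<bar> = \<bar>cs n 2 * A - C\<bar>" using s2 by (metis abs_mult abs_of_pos)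
    also have "\<dots> \<le> \<bar>cs n 2 * A\<bar> + \<bar>C\<bar>" by (rule abs_triangle_ineq4)
    also have "\<bar>cs n 2 * A\<bar> \<le> 1 * 3"
      unfolding abs_mult using abs abs_cs_le_one by (intro mult_mono) auto
    finally have "\<bar>y $ 1\<bar> \<le> 6 / sn n 2" using abs s2 by (simp add: field_simps)
    moreover have "norm y \<le> \<bar>y $ 1\<bar> + \<bar>y $ 2\<bar>"
      using norm_le_l1_cart[of y] by (simp add: sum_2)
    ultimately show ?thesis using abs A by simp
  qed
  then show ?thesis unfolding bounded_iff by blast
qed

lemma is_ge5gon_iff: "is_ge5gon Lines c \<longleftrightarrow> c = cell 0"
proof
  have "0 \<in> - \<Union>Lines" unfolding mem_face_points_iff by (simp add: g_zero_iff)
  then have "cell 0 \<in> polygons Lines"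
    using bounded_center unfolding polygons_def faces_eq by blast
  then show "is_ge5gon Lines c" if "c = cell 0"
    using that n by (simp add: is_ge5gon_def card_edges_of_center)
  assume c: "is_ge5gon Lines c"
  then obtain y where y: "c = cell y" "\<And>i. g i y \<noteq> 0"
    unfolding is_ge5gon_def polygons_def faces_eq using mem_face_points_iff by auto
  have "\<not> y \<bullet> p m > 1" for m
    using card_edges_of_noncentral[of y m] y c by (auto simp: is_ge5gon_def)
  then have "y \<bullet> p m < 1" for m using y(2)[of m] unfolding g_zero_iff by (metis linorder_cases)
  then have "sgn (g i y) = sgn (g i 0)" for i using s_cases[of i] by (auto simp: g_eq)
  then show "c = cell 0" using y(1) by (simp add: cell_eq_iff)
qed

lemma Lines_mem: "Lines \<in> one_ge5gon_arrangements"
proof -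
  have "adjacent_to Lines (line k) (cell 0)" for k
  proof -
    have "cell (p k) \<in> edges_of Lines (cell 0)"
      using g_p_zero_iff le_p_zero unfolding edges_of_cell by blast
    moreover have "cell (p k) \<subseteq> line k"
      using cell_zero_iff[of _ "p k" k] g_p_zero_iff[of k k] by (auto simp: mem_line_iff)
    ultimately show ?thesis unfolding adjacent_to_def by blast
  qed
  then have "\<forall>c. is_ge5gon Lines c \<longrightarrow> (\<forall>l\<in>Lines. adjacent_to Lines l c)"
    by (simp add: is_ge5gon_iff)
  moreover have "\<exists>!c. is_ge5gon Lines c" unfolding is_ge5gon_iff by simp
  ultimately show ?thesis
    unfolding one_ge5gon_arrangements_def using simple_euclidean_arrangement_Lines by blast
qed

subsection \<open>The ends of the lines\<close>

lemma sn_1_pos: "0 < sn n 1" using n by (intro sn_pos) auto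

text \<open>By \<open>abs_sn_ge\<close> the scaled sine has absolute value at least 3, which exceeds
  the perturbation. For points of line \<open>k\<close> the perturbation is
  \<open>s k * cs n (i - k) - s i\<close>, whence the bound 2.\<close>

lemma sgn_scaled_sn_add:
  assumes "\<not> int n dvd m" "\<bar>e\<bar> \<le> 2"
  shows "sgn (3 / sn n 1 * sn n m + e) = sgn (sn n m)"
proof -
  have "3 / sn n 1 * sn n 1 \<le> 3 / sn n 1 * \<bar>sn n m\<bar>"
    using abs_sn_ge[OF n_pos assms(1)] sn_1_pos by (intro mult_left_mono) auto
  then have ge: "3 \<le> 3 / sn n 1 * \<bar>sn n m\<bar>" using sn_1_pos by simp
  show ?thesis
  proof (cases "sn n m" "0::real" rule: linorder_cases)
    case less
    then have "3 / sn n 1 * sn n m + e < 0" using ge assms(2) by simp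
    then show ?thesis using less by simp
  next
    case greater
    then have "3 / sn n 1 * sn n m + e > 0" using ge assms(2) by simp
    then show ?thesis using greater by simp
  qed (use assms sn_eq_0_iff n_pos in auto)
qed

text \<open>The offset is large enough for the point to lie beyond all crossings with the other lines.\<close>

definition ray_pt :: "int \<Rightarrow> real^2"
  where "ray_pt k = pt k (3 / sn n 1)"

text \<open>The choice \<open>s\<close> does not occur on the right: far out, the side of each line
  depends on the directions alone. This makes the cyclic order of the ends the same for all
  choices.\<close>

lemma sgn_g_ray_pt: "sgn (g i (ray_pt k)) = sgn (sn n (k - i))"
proof (cases "int n dvd k - i")
  case True
  then have "g i (ray_pt k) = 0" using g_zero_cong[of i k] g_pt_self[of k]
    by (simp add: ray_pt_def dvd_diff_commute)
  moreover have "sn n (k - i) = 0" using True by (simp add: sn_eq_0_iff n_pos)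
  ultimately show ?thesis by simp
next
  case False
  have "\<bar>s k * cs n (i - k) - s i\<bar> \<le> \<bar>s k * cs n (i - k)\<bar> + \<bar>s i\<bar>" by (rule abs_triangle_ineq4)
  also have "\<dots> \<le> 2"
    using s_cases[of i] s_cases[of k] abs_cs_le_one[of n "i - k"] by auto
  finally have "sgn (3 / sn n 1 * sn n (k - i) + (s k * cs n (i - k) - s i)) = sgn (sn n (k - i))"
    by (rule sgn_scaled_sn_add[OF False])
  moreover have "g i (ray_pt k) = 3 / sn n 1 * sn n (k - i) + (s k * cs n (i - k) - s i)"
    by (simp add: g_pt ray_pt_def)
  ultimately show ?thesis by simp
qed

lemma g_ray_pt_zero_iff: "g i (ray_pt k) = 0 \<longleftrightarrow> int n dvd i - k"
  using sgn_g_ray_pt[of i k] sn_eq_0_iff[OF n_pos, of "k - i"]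
  by (metis dvd_diff_commute sgn_0_0)

lemma cell_ray_pt_mem_edges: "cell (ray_pt k) \<in> edges Lines"
  unfolding edges_eq by (intro imageI) (unfold mem_edge_points_iff, simp add: g_ray_pt_zero_iff exI[of _ k])

lemma sn_shift_mult: "sn n (i + q * int n) = (if even q then 1 else -1) * sn n i"
  by (rule antiperiodic_shift) (rule sn_shift[OF n_pos])

text \<open>The indices \<open>k\<close> and \<open>k + n\<close> denote opposite ends of the same
  line, so the period is \<open>2 * n\<close> and not \<open>n\<close>.\<close>

lemma cell_ray_pt_eq_iff: "cell (ray_pt j) = cell (ray_pt k) \<longleftrightarrow> 2 * int n dvd j - k"
proof
  assume "2 * int n dvd j - k"
  then obtain q where "j - k = 2 * int n * q" ..
  then have "j - i = (k - i) + (2 * q) * int n" for i by (simp add: algebra_simps)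
  then have "sn n (j - i) = sn n (k - i)" for i by (simp only: sn_shift_mult) simp
  then show "cell (ray_pt j) = cell (ray_pt k)" by (simp add: cell_eq_iff sgn_g_ray_pt)
next
  assume "cell (ray_pt j) = cell (ray_pt k)"
  then have eq: "sgn (sn n (j - i)) = sgn (sn n (k - i))" for i
    by (simp add: cell_eq_iff sgn_g_ray_pt)
  from eq[of k] have "int n dvd j - k" by (simp add: sn_eq_0_iff n_pos sgn_0_0)
  then obtain q where q: "j - k = int n * q" ..
  \<comment> \<open>The line \<open>k - 1\<close> tells the two ends of line \<open>k\<close> apart:
    there its sign is that of \<open>sn n 1\<close> or of \<open>- sn n 1\<close>.\<close>
  have "j - (k - 1) = 1 + q * int n" using q by (simp add: algebra_simps)
  then have "sn n (j - (k - 1)) = (if even q then 1 else -1) * sn n 1" by (simp only: sn_shift_mult)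
  then have "even q" using eq[of "k - 1"] sn_1_pos by (auto split: if_splits)
  then show "2 * int n dvd j - k" using q by auto
qed

section \<open>Crossings along one line and the classification of its ends\<close>

definition crossing :: "int \<Rightarrow> int \<Rightarrow> real"
  where "crossing k i = (s i - s k * cs n (i - k)) / sn n (k - i)"

lemma g_pt_crossing: "\<not> int n dvd i - k \<Longrightarrow> g i (pt k t) = sn n (k - i) * (t - crossing k i)"
proof -
  assume "\<not> int n dvd i - k"
  then have "sn n (k - i) \<noteq> 0" by (simp add: sn_eq_0_iff n_pos dvd_diff_commute)
  then show ?thesis by (simp add: g_pt crossing_def field_simps)
qed

text \<open>Numerator and denominator both change sign when \<open>i\<close> grows by
  \<open>n\<close>, so the value depends only on \<open>i\<close> modulo \<open>n\<close>.\<close>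

lemma finite_crossing: "finite (range (crossing k))"
proof -
  have "crossing k i = crossing k (i mod int n)" for i
  proof -
    have "i = i mod int n + (i div int n) * int n" by simp
    moreover have "crossing k (j + q * int n) = crossing k j" for j q
    proof -
      have "s (j + q * int n) = (if even q then 1 else -1) * s j"
        using antiperiodic_shift[of s, OF s_shift] .
      moreover have "cs n ((j - k) + q * int n) = (if even q then 1 else -1) * cs n (j - k)"
        using antiperiodic_shift[of "cs n", OF cs_shift[OF n_pos]] .
      moreover have "sn n ((k - j) + (- q) * int n) = (if even q then 1 else -1) * sn n (k - j)"
        by (simp only: sn_shift_mult even_minus)
      moreover have "j + q * int n - k = (j - k) + q * int n"
        "k - (j + q * int n) = (k - j) + (- q) * int n" by simp_all
      ultimately show ?thesis unfolding crossing_def by (simp only:) (auto simp: diff_divide_distrib)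
    qed
    ultimately show ?thesis by metis
  qed
  then have "range (crossing k) \<subseteq> crossing k ` {0..<int n}" using n_pos by fastforce
  then show ?thesis by (rule finite_subset) simp
qed

lemma pt_inj: "pt k t = pt k t' \<Longrightarrow> t = t'"
proof -
  assume "pt k t = pt k t'"
  then have "t *\<^sub>R direction n k = t' *\<^sub>R direction n k" by (simp add: pt_def)
  moreover have "direction n k \<noteq> 0"
    using normal_inner_direction[of n "k - 1" k] sn_1_pos by auto
  ultimately show ?thesis by simp
qed

lemma crossing_vertex:
  assumes "\<not> int n dvd i - k"
  shows "pt k (crossing k i) \<in> vertices Lines"
  unfolding mem_vertices_iff
  by (intro exI[of _ i] exI[of _ k]) (simp add: assms g_pt_crossing)

lemma le_pt_iff:
  "le (pt k t) (pt k t') \<longleftrightarrow> (\<forall>i. \<not> int n dvd i - k \<longrightarrow> t = crossing k i \<or> sgn (t - crossing k i) = sgn (t' - crossing k i))"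
proof -
  have "g i (pt k t) = 0 \<or> sgn (g i (pt k t)) = sgn (g i (pt k t')) \<longleftrightarrow>
     (\<not> int n dvd i - k \<longrightarrow> t = crossing k i \<or> sgn (t - crossing k i) = sgn (t' - crossing k i))" for i
  proof (cases "int n dvd i - k")
    case True
    then show ?thesis using g_zero_cong[OF True] by simp
  next
    case False
    then have "sn n (k - i) \<noteq> 0" by (simp add: sn_eq_0_iff n_pos dvd_diff_commute)
    then show ?thesis using False by (auto simp: g_pt_crossing sgn_mult sgn_0_0)
  qed
  then show ?thesis by (simp add: le_def)
qed

text \<open>The nearest crossing above \<open>t\<close> bounds the edge through
  \<open>pt k t\<close>, because no other line is crossed on the way.\<close>

lemma upper_vertex:
  assumes "\<And>i. \<not> int n dvd i - k \<Longrightarrow> t \<noteq> crossing k i" "\<not> int n dvd j - k" "crossing k j > t"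
  shows "\<exists>r>t. pt k r \<in> vertices Lines \<and> le (pt k r) (pt k t)"
proof -
  define A where "A = {crossing k i | i. \<not> int n dvd i - k \<and> crossing k i > t}"
  have fin: "finite A" by (rule finite_subset[OF _ finite_crossing[of k]]) (auto simp: A_def)
  moreover have "A \<noteq> {}" using assms by (auto simp: A_def)
  ultimately have "Min A \<in> A" by (rule Min_in)
  then obtain i where i: "Min A = crossing k i" "\<not> int n dvd i - k" "crossing k i > t"
    by (auto simp: A_def)
  have "le (pt k (crossing k i)) (pt k t)"
    unfolding le_pt_iff
  proof (intro allI impI)
    fix l assume l: "\<not> int n dvd l - k"
    have "crossing k i \<le> crossing k l" if "crossing k l > t"
      using Min_le[OF fin, of "crossing k l"] that l i(1) by (auto simp: A_def)
    then show "crossing k i = crossing k l \<or> sgn (crossing k i - crossing k l) = sgn (t - crossing k l)"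
      using assms(1)[OF l] i(3) by (cases "crossing k l > t") (auto simp: sgn_if)
  qed
  then show ?thesis using crossing_vertex i by blast
qed

lemma lower_vertex:
  assumes "\<And>i. \<not> int n dvd i - k \<Longrightarrow> t \<noteq> crossing k i" "\<not> int n dvd j - k" "crossing k j < t"
  shows "\<exists>r<t. pt k r \<in> vertices Lines \<and> le (pt k r) (pt k t)"
proof -
  define A where "A = {crossing k i | i. \<not> int n dvd i - k \<and> crossing k i < t}"
  have fin: "finite A" by (rule finite_subset[OF _ finite_crossing[of k]]) (auto simp: A_def)
  moreover have "A \<noteq> {}" using assms by (auto simp: A_def)
  ultimately have "Max A \<in> A" by (rule Max_in)
  then obtain i where i: "Max A = crossing k i" "\<not> int n dvd i - k" "crossing k i < t"
    by (auto simp: A_def)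
  have "le (pt k (crossing k i)) (pt k t)"
    unfolding le_pt_iff
  proof (intro allI impI)
    fix l assume l: "\<not> int n dvd l - k"
    have "crossing k l \<le> crossing k i" if "crossing k l < t"
      using Max_ge[OF fin, of "crossing k l"] that l i(1) by (auto simp: A_def)
    then show "crossing k i = crossing k l \<or> sgn (crossing k i - crossing k l) = sgn (t - crossing k l)"
      using assms(1)[OF l] i(3) by (cases "crossing k l < t") (auto simp: sgn_if)
  qed
  then show ?thesis using crossing_vertex i by blast
qed

lemma le_ray_ptD:
  assumes "v \<in> vertices Lines" "le v (ray_pt k)"
  obtains i where "\<not> int n dvd i - k" "v = pt k (crossing k i)"
    "\<And>j. \<not> int n dvd j - k \<Longrightarrow> crossing k j \<le> crossing k i"
proof -
  have "g k v = 0" using assms(2) g_pt_self[of k]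
    unfolding le_def ray_pt_def by (metis sgn_0_0)
  then obtain t where t: "v = pt k t" using pt_of_line by blast
  obtain i where i: "\<not> int n dvd i - k" "g i v = 0"
  proof -
    obtain i j where ij: "\<not> int n dvd i - j" "g i v = 0" "g j v = 0"
      using assms(1) unfolding mem_vertices_iff by blast
    have "\<not> int n dvd i - k \<or> \<not> int n dvd j - k"
      using ij(1) dvd_diff[of "int n" "i - k" "j - k"] by (metis diff_diff_eq2 diff_add_cancel)
    then show thesis using ij that by blast
  qed
  have "sn n (k - j) \<noteq> 0" if "\<not> int n dvd j - k" for j
    using that by (simp add: sn_eq_0_iff n_pos dvd_diff_commute)
  note nz = this
  have ti: "t = crossing k i" using i g_pt_crossing[OF i(1)] nz t by simp
  have "crossing k j \<le> t" if j: "\<not> int n dvd j - k" for j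
  proof -
    have "t = crossing k j \<or> sgn (sn n (k - j) * (t - crossing k j)) = sgn (sn n (k - j))"
      using assms(2) nz[OF j] unfolding le_def sgn_g_ray_pt t g_pt_crossing[OF j]
      by (metis eq_iff_diff_eq_0 g_pt_crossing[OF j] mult_eq_0_iff)
    then show ?thesis using nz[OF j] by (auto simp: sgn_if zero_less_mult_iff split: if_splits)
  qed
  then show thesis using that i ti t by blast
qed

lemma is_ray_cell_ray_pt: "is_ray Lines (cell (ray_pt k))"
  unfolding is_ray_def
proof (intro conjI ballI impI)
  show "cell (ray_pt k) \<in> edges Lines" by (rule cell_ray_pt_mem_edges)
  fix v w assume v: "v \<in> vertices Lines" "v \<in> closure (cell (ray_pt k))"
    and w: "w \<in> vertices Lines" "w \<in> closure (cell (ray_pt k))"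
  have "le v (ray_pt k)" "le w (ray_pt k)"
    using v w vertex_mem_closure_cell_iff by blast+
  then show "v = w" using v(1) w(1) le_ray_ptD by (metis order_antisym)
qed

text \<open>If line \<open>k\<close> were crossed on both sides of the edge, the nearest crossings
  above and below would be two different vertices of it. So all crossings lie on one side, and the
  edge is the end \<open>k\<close> or the end \<open>k + n\<close>.\<close>

lemma is_rayE:
  assumes "is_ray Lines e"
  obtains k where "e = cell (ray_pt k)"
proof -
  obtain x k where x: "e = cell x" "\<And>i. g i x = 0 \<longleftrightarrow> int n dvd i - k"
    using assms unfolding is_ray_def edges_eq using mem_edge_points_iff by blast
  have "g k x = 0" using x(2) by simp
  then obtain t where t: "x = pt k t" using pt_of_line by blast
  have nz: "sn n (k - i) \<noteq> 0" if "\<not> int n dvd i - k" for i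
    using that by (simp add: sn_eq_0_iff n_pos dvd_diff_commute)
  have tr: "t \<noteq> crossing k i" if "\<not> int n dvd i - k" for i
    using x(2)[of i] that g_pt_crossing[OF that, of t] t by auto
  have uniq: "r = r'" if "pt k r \<in> vertices Lines" "le (pt k r) (pt k t)"
     "pt k r' \<in> vertices Lines" "le (pt k r') (pt k t)" for r r'
    using assms that vertex_mem_closure_cell_iff pt_inj unfolding is_ray_def x(1) t by blast
  have "(\<forall>i. \<not> int n dvd i - k \<longrightarrow> crossing k i < t) \<or> (\<forall>i. \<not> int n dvd i - k \<longrightarrow> crossing k i > t)"
  proof (rule ccontr)
    assume "\<not> ?thesis"
    then obtain i j where ij: "\<not> int n dvd i - k" "\<not> crossing k i < t"
        "\<not> int n dvd j - k" "\<not> crossing k j > t"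
      by blast
    then have gt: "crossing k i > t" and lt: "crossing k j < t"
      using tr[of i] tr[of j] by linarith+
    obtain r where r: "r > t" "pt k r \<in> vertices Lines" "le (pt k r) (pt k t)"
      using upper_vertex[OF tr ij(1) gt] by blast
    obtain r' where r': "r' < t" "pt k r' \<in> vertices Lines" "le (pt k r') (pt k t)"
      using lower_vertex[OF tr ij(3) lt] by blast
    show False using uniq[OF r(2,3) r'(2,3)] r(1) r'(1) by simp
  qed
  then show thesis
  proof
    assume *: "\<forall>i. \<not> int n dvd i - k \<longrightarrow> crossing k i < t"
    have "sgn (g i x) = sgn (sn n (k - i))" for i
    proof (cases "int n dvd i - k")
      case True
      then have "g i x = 0" "sn n (k - i) = 0"
        using x(2)[of i] by (simp_all add: sn_eq_0_iff n_pos dvd_diff_commute)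
      then show ?thesis by simp
    next
      case False
      then show ?thesis using * by (simp add: t g_pt_crossing sgn_mult)
    qed
    then show thesis using that[of k] x(1) by (simp add: cell_eq_iff sgn_g_ray_pt)
  next
    assume *: "\<forall>i. \<not> int n dvd i - k \<longrightarrow> crossing k i > t"
    have "sgn (g i x) = sgn (sn n ((k - i) + int n))" for i
    proof (cases "int n dvd i - k")
      case True
      then have "g i x = 0" "sn n (k - i) = 0"
        using x(2)[of i] by (simp_all add: sn_eq_0_iff n_pos dvd_diff_commute)
      then show ?thesis by (simp add: sn_shift n_pos)
    next
      case False
      then show ?thesis using * by (simp add: t g_pt_crossing sgn_mult sn_shift n_pos sgn_minus)
    qed
    then show thesis using that[of "k + int n"] x(1) by (simp add: cell_eq_iff sgn_g_ray_pt algebra_simps)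
  qed
qed

section \<open>Ends that share a face\<close>

definition mid_pt :: "int \<Rightarrow> real^2"
  where "mid_pt j = (3 / sn n 1) *\<^sub>R (direction n j + direction n (j + 1))"

lemma g_mid_pt: "g i (mid_pt j) = 3 / sn n 1 * sn n (j - i) + 3 / sn n 1 * sn n (j + 1 - i) - s i"
  unfolding g_def mid_pt_def inner_scaleR_right inner_add_right normal_inner_direction
  by (simp only: distrib_left)

lemma scaled_sn_ge: "0 < sn n m \<Longrightarrow> 3 \<le> 3 / sn n 1 * sn n m"
  and scaled_sn_le: "sn n m < 0 \<Longrightarrow> 3 / sn n 1 * sn n m \<le> -3"
proof -
  have "sn n 1 \<le> \<bar>sn n m\<bar>" if "sn n m \<noteq> 0"
    using that abs_sn_ge[OF n_pos, of m] by (simp add: sn_eq_0_iff n_pos)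
  then show "0 < sn n m \<Longrightarrow> 3 \<le> 3 / sn n 1 * sn n m"
    "sn n m < 0 \<Longrightarrow> 3 / sn n 1 * sn n m \<le> -3"
    using sn_1_pos by (simp_all add: field_simps)
qed

text \<open>\<open>mid_pt j\<close> lies far out between the directions \<open>j\<close> and
  \<open>j + 1\<close>. Its two sine terms do not have opposite signs and at least one has absolute
  value 3 or more, so the remaining term \<open>s i\<close> cannot change the sign.\<close>

lemma sgn_g_mid_pt:
  assumes "sn n (j - i) \<noteq> 0 \<or> sn n (j + 1 - i) \<noteq> 0"
  shows "g i (mid_pt j) \<noteq> 0"
    and "sn n (j - i) = 0 \<or> sgn (sn n (j - i)) = sgn (g i (mid_pt j))"
    and "sn n (j + 1 - i) = 0 \<or> sgn (sn n (j + 1 - i)) = sgn (g i (mid_pt j))"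
proof -
  define a where "a = sn n (j - i)"
  define b where "b = sn n (j + 1 - i)"
  define x where "x = 3 / sn n 1 * a"
  define y where "y = 3 / sn n 1 * b"
  have gm: "g i (mid_pt j) = x + y - s i" by (simp only: g_mid_pt a_def b_def x_def y_def)
  have "0 \<le> sn n (j - i) * sn n (j - i + 1)" by (rule sn_mult_sn_Suc_nonneg[OF n_pos])
  moreover have "j - i + 1 = j + 1 - i" by simp
  ultimately have "0 \<le> a * b" by (simp only: a_def b_def)
  moreover have "a \<noteq> 0 \<or> b \<noteq> 0" using assms by (simp add: a_def b_def)
  ultimately have "(a \<ge> 0 \<and> b \<ge> 0 \<and> (a > 0 \<or> b > 0)) \<or> (a \<le> 0 \<and> b \<le> 0 \<and> (a < 0 \<or> b < 0))"
    by (auto simp: zero_le_mult_iff)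
  then have "(a \<ge> 0 \<and> b \<ge> 0 \<and> g i (mid_pt j) > 0) \<or> (a \<le> 0 \<and> b \<le> 0 \<and> g i (mid_pt j) < 0)"
  proof
    assume h: "a \<ge> 0 \<and> b \<ge> 0 \<and> (a > 0 \<or> b > 0)"
    have "x \<ge> 0" "y \<ge> 0" using h sn_1_pos by (auto simp: x_def y_def)
    moreover have "x \<ge> 3 \<or> y \<ge> 3"
      using h scaled_sn_ge unfolding x_def y_def a_def b_def by blast
    ultimately show ?thesis using h s_cases[of i] unfolding gm by auto
  next
    assume h: "a \<le> 0 \<and> b \<le> 0 \<and> (a < 0 \<or> b < 0)"
    have "x \<le> 0" "y \<le> 0" using h sn_1_pos
      by (auto simp: x_def y_def intro: mult_nonneg_nonpos divide_nonpos_pos)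
    moreover have "x \<le> -3 \<or> y \<le> -3"
      using h scaled_sn_le unfolding x_def y_def a_def b_def by blast
    ultimately show ?thesis using h s_cases[of i] unfolding gm by auto
  qed
  then show "g i (mid_pt j) \<noteq> 0"
    "sn n (j - i) = 0 \<or> sgn (sn n (j - i)) = sgn (g i (mid_pt j))"
    "sn n (j + 1 - i) = 0 \<or> sgn (sn n (j + 1 - i)) = sgn (g i (mid_pt j))"
    unfolding a_def[symmetric] b_def[symmetric] by (auto simp: sgn_if)
qed

lemma le_ray_pt_left_iff:
  "le (ray_pt k) y \<longleftrightarrow> (\<forall>i. sn n (k - i) = 0 \<or> sgn (sn n (k - i)) = sgn (g i y))"
  unfolding le_def sgn_g_ray_pt by (metis sgn_0_0 sgn_g_ray_pt)

lemma share_face_ray_Suc: "share_face Lines (cell (ray_pt j)) (cell (ray_pt (j + 1)))"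
proof -
  have "sn n (j - i) \<noteq> 0 \<or> sn n (j + 1 - i) \<noteq> 0" for i
  proof (rule ccontr)
    assume "\<not> ?thesis"
    then have "int n dvd j + 1 - i" "int n dvd j - i" by (simp_all add: sn_eq_0_iff n_pos)
    from dvd_diff[OF this] show False using n by simp
  qed
  note sgn_g_mid_pt[OF this]
  then have "mid_pt j \<in> - \<Union>Lines" "le (ray_pt j) (mid_pt j)" "le (ray_pt (j + 1)) (mid_pt j)"
    unfolding mem_face_points_iff le_ray_pt_left_iff by blast+
  then show ?thesis
    unfolding share_face_def faces_eq using cell_subset_closure_cell_iff by blast
qed

text \<open>No line strictly separates two ends on a common face. Ends that are neither equal nor
  adjacent are separated by a neighbour of line \<open>j\<close>: by line \<open>j + 1\<close> when
  \<open>k\<close> is at most a half turn ahead of \<open>j\<close>, and by line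
  \<open>j - 1\<close> otherwise.\<close>

lemma share_face_rayD:
  assumes "share_face Lines (cell (ray_pt j)) (cell (ray_pt k))"
  shows "2 * int n dvd k - j \<or> 2 * int n dvd k - (j + 1) \<or> 2 * int n dvd k - (j - 1)"
proof -
  obtain y where y: "le (ray_pt j) y" "le (ray_pt k) y"
    using assms cell_subset_closure_cell_iff unfolding share_face_def faces_eq by blast
  have no_sep: "\<not> (sn n (j - i) < 0 \<and> sn n (k - i) > 0 \<or> sn n (j - i) > 0 \<and> sn n (k - i) < 0)" for i
  proof -
    have "sn n (j - i) = 0 \<or> sgn (sn n (j - i)) = sgn (g i y)"
      "sn n (k - i) = 0 \<or> sgn (sn n (k - i)) = sgn (g i y)"
      using y unfolding le_ray_pt_left_iff by blast+
    then have "sn n (j - i) = 0 \<or> sn n (k - i) = 0 \<or> sgn (sn n (j - i)) = sgn (sn n (k - i))"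
      by metis
    then show ?thesis by (auto simp: sgn_if split: if_splits)
  qed
  define N where "N = 2 * int n"
  define m where "m = (k - j) mod N"
  define q where "q = (k - j) div N"
  have N: "N > 0" using n by (simp add: N_def)
  have m: "0 \<le> m" "m < N" using N by (simp_all add: m_def)
  have kj: "k - j = m + q * N" by (simp add: m_def q_def)
  have snk: "sn n (k - i) = sn n (j + m - i)" for i
  proof -
    have "k - i = (j + m - i) + (2 * q) * int n" using kj by (simp add: N_def algebra_simps)
    then show ?thesis by (simp only: sn_shift_mult) simp
  qed
  consider "m = 0" | "m = 1" | "m = N - 1" | "2 \<le> m" "m \<le> int n" | "int n < m" "m \<le> N - 2"
    using m by linarith
  then show ?thesis
  proof cases
    case 1 then show ?thesis using kj by (simp add: N_def)
  next
    case 2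
    then have "k - (j + 1) = N * q" using kj by (simp add: algebra_simps)
    then show ?thesis unfolding N_def by (metis dvd_triv_left)
  next
    case 3
    then have "k - (j - 1) = N * (q + 1)" using kj by (simp add: algebra_simps)
    then show ?thesis unfolding N_def by (metis dvd_triv_left)
  next
    case 4
    have "sn n (j - (j + 1)) < 0" using sn_1_pos sn_minus[of n 1] by simp
    moreover have "sn n (k - (j + 1)) > 0" unfolding snk using 4 by (intro sn_pos) auto
    ultimately show ?thesis using no_sep[of "j + 1"] by blast
  next
    case 5
    have "sn n (j - (j - 1)) > 0" using sn_1_pos by simp
    moreover have "sn n (k - (j - 1)) < 0"
    proof -
      have "sn n (m + 1 - int n) > 0" using 5 by (intro sn_pos) (auto simp: N_def)
      moreover have "sn n (m + 1) = - sn n (m + 1 - int n)"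
        using sn_shift[OF n_pos, of "m + 1 - int n"] by simp
      moreover have "j + m - (j - 1) = m + 1" by simp
      ultimately show ?thesis unfolding snk by simp
    qed
    ultimately show ?thesis using no_sep[of "j - 1"] by blast
  qed
qed

section \<open>Adjacent ends that share a vertex\<close>

lemma normal_interpolation:
  "sn n 1 *\<^sub>R normal n i = sn n (j + 1 - i) *\<^sub>R normal n j + sn n (i - j) *\<^sub>R normal n (j + 1)"
proof -
  define m where "m = i - j"
  have i: "i = j + m" "j + 1 - i = 1 - m" "i - j = m" by (simp_all add: m_def)
  have "sn n 1 * sn n (j + m) = sn n (1 - m) * sn n j + sn n m * sn n (j + 1)"
    "sn n 1 * cs n (j + m) = sn n (1 - m) * cs n j + sn n m * cs n (j + 1)"
    unfolding sn_add cs_add sn_diff by algebra+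
  then show ?thesis unfolding i by (simp add: vec_eq_iff forall_2 normal_def)
qed

text \<open>Each normal is a combination of two adjacent ones with sines as coefficients. At the
  crossing of lines \<open>j\<close> and \<open>j + 1\<close> the side of any third line is thus
  decided by three signs.\<close>

lemma g_interpolation:
  assumes "g j v = 0" "g (j + 1) v = 0"
  shows "sn n 1 * g (j - m) v = sn n (m + 1) * s j - sn n m * s (j + 1) - sn n 1 * s (j - m)"
proof -
  have "sn n 1 * (normal n (j - m) \<bullet> v) =
      sn n (j + 1 - (j - m)) * (normal n j \<bullet> v) + sn n (j - m - j) * (normal n (j + 1) \<bullet> v)"
    using normal_interpolation[of "j - m" j]
    by (metis inner_add_left inner_scaleR_left)
  moreover have "j + 1 - (j - m) = m + 1" "j - m - j = - m" by simp_all
  moreover have "normal n j \<bullet> v = s j" "normal n (j + 1) \<bullet> v = s (j + 1)"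
    using assms by (simp_all add: g_def)
  ultimately show ?thesis by (simp add: g_def sn_minus right_diff_distrib)
qed

text \<open>The addition theorem with \<open>cs n 1 < 1\<close> and
  \<open>\<bar>cs n i\<bar> \<le> 1\<close> shows that adjacent sines in this range differ by less
  than \<open>sn n 1\<close>, the weight of the third sign in
  \<open>g_interpolation\<close>.\<close>

lemma sn_Suc_bounds:
  assumes "1 \<le> m" "m \<le> int n - 2"
  shows "sn n m > 0" "sn n (m + 1) > 0" "sn n (m + 1) < sn n m + sn n 1"
    "sn n m < sn n (m + 1) + sn n 1" "sn n m \<ge> sn n 1"
proof -
  show pos: "sn n m > 0" "sn n (m + 1) > 0" using assms by (auto intro: sn_pos)
  have "(cs n 1)\<^sup>2 < 1" using sn_cs_squared[of n 1] sn_1_pos by (smt (verit) zero_less_power)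
  then have c1: "cs n 1 < 1" by (smt (verit) one_le_power)
  have "sn n m * cs n 1 < sn n m * 1" "sn n (m + 1) * cs n 1 < sn n (m + 1) * 1"
    using pos c1 by (intro mult_strict_left_mono; simp)+
  moreover have "\<bar>cs n i * sn n 1\<bar> \<le> sn n 1" for i
    using abs_cs_le_one[of n i] sn_1_pos mult_right_mono[of "\<bar>cs n i\<bar>" 1 "sn n 1"]
    by (simp add: abs_mult)
  ultimately show "sn n (m + 1) < sn n m + sn n 1" "sn n m < sn n (m + 1) + sn n 1"
    using sn_add[of n m 1] sn_diff[of n "m + 1" 1] by (smt (verit) add_diff_cancel_right')+
  have "\<not> int n dvd m" using sn_eq_0_iff[OF n_pos, of m] pos by auto
  then show "sn n m \<ge> sn n 1" using abs_sn_ge[OF n_pos, of m] pos by simp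
qed

lemma s_shift_mult: "s (i + q * int n) = (if even q then 1 else -1) * s i"
  by (rule antiperiodic_shift) (rule s_shift)

text \<open>A window that starts in \<open>{0..<int n}\<close> contains two of the indices 0, 1, 2,
  \<open>n\<close>, \<open>n + 1\<close> with opposite signs, fixed by \<open>s012\<close> and
  \<open>s_shift\<close>. Any other window is a shift of such a one, at worst with both signs
  exchanged.\<close>

lemma both_signs_in_window:
  assumes "e = 1 \<or> e = -1"
  shows "\<exists>i. w \<le> i \<and> i < w + int n \<and> s i = e"
proof -
  define r where "r = w mod int n"
  define q where "q = w div int n"
  have r: "0 \<le> r" "r < int n" and w: "w = r + q * int n" using n by (simp_all add: r_def q_def)
  have base: "\<exists>i. r \<le> i \<and> i < r + int n \<and> s i = e" if "e = 1 \<or> e = -1" for e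
  proof -
    have sn': "s (int n) = -1" "s (int n + 1) = 1"
      using s_shift[of 0] s_shift[of 1] s012 by (simp_all add: add.commute)
    consider "r = 0" | "r = 1" | "r = 2" | "r > 2" using r by linarith
    then show ?thesis
    proof cases
      case 1 then show ?thesis using that s012 n by (auto intro: exI[of _ 0] exI[of _ 1])
    next
      case 2 then show ?thesis using that s012 n by (auto intro: exI[of _ 2] exI[of _ 1])
    next
      case 3 then show ?thesis using that s012 sn' n by (auto intro: exI[of _ 2] exI[of _ "int n"])
    next
      case 4 then show ?thesis using that sn' r
        by (auto intro: exI[of _ "int n + 1"] exI[of _ "int n"])
    qed
  qed
  define \<sigma> :: real where "\<sigma> = (if even q then 1 else -1)"
  have "\<sigma> * e = 1 \<or> \<sigma> * e = -1" using assms by (auto simp: \<sigma>_def)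
  then obtain i where i: "r \<le> i" "i < r + int n" "s i = \<sigma> * e" using base by blast
  have "s (i + q * int n) = e" unfolding s_shift_mult i(3) by (auto simp: \<sigma>_def)
  then show ?thesis using i w by (intro exI[of _ "i + q * int n"]) auto
qed

text \<open>One index per line suffices, since the signs on both sides are reversed together when
  the index moves by \<open>n\<close>.\<close>

lemma le_ray_pt_right_iff:
  "le v (ray_pt k) \<longleftrightarrow>
    (\<forall>m\<in>{0..<int n}. g (k - m) v = 0 \<or> sgn (g (k - m) v) = sgn (sn n m))"
  unfolding le_def sgn_g_ray_pt
proof
  assume "\<forall>i. g i v = 0 \<or> sgn (g i v) = sgn (sn n (k - i))"
  then show "\<forall>m\<in>{0..<int n}. g (k - m) v = 0 \<or> sgn (g (k - m) v) = sgn (sn n m)"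
    by (metis diff_diff_eq2 add_diff_cancel_left')
next
  assume R: "\<forall>m\<in>{0..<int n}. g (k - m) v = 0 \<or> sgn (g (k - m) v) = sgn (sn n m)"
  show "\<forall>i. g i v = 0 \<or> sgn (g i v) = sgn (sn n (k - i))"
  proof
    fix i
    define m where "m = (k - i) mod int n"
    define q where "q = (k - i) div int n"
    have ki: "k - i = m + q * int n" by (simp add: m_def q_def)
    then have i: "i = (k - m) + (- q) * int n" by (simp add: algebra_simps)
    have "m \<in> {0..<int n}" using n by (simp add: m_def)
    then have "g (k - m) v = 0 \<or> sgn (g (k - m) v) = sgn (sn n m)" using R by blast
    moreover have "sn n (k - i) = (if even q then 1 else -1) * sn n m"
      unfolding ki by (rule sn_shift_mult)
    moreover have "g i v = (if even q then 1 else -1) * g (k - m) v"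
      unfolding i g_shift_mult by simp
    ultimately show "g i v = 0 \<or> sgn (g i v) = sgn (sn n (k - i))"
      by (auto simp: sgn_mult)
  qed
qed

text \<open>The only candidate is the crossing of lines \<open>j\<close> and \<open>j + 1\<close>.
  Line \<open>j - m\<close> admits it when \<open>sn n (m + 1) * s j - sn n m * s (j + 1)\<close> is
  at least \<open>sn n 1 * s (j - m)\<close>. For the signs 1, -1 this always holds, and for -1, 1
  it fails at \<open>m = 1\<close>. For equal signs the left side is smaller than
  \<open>sn n 1\<close>, so it fails wherever \<open>s (j - m) = 1\<close>.\<close>

lemma share_vertex_ray_Suc_iff:
  "share_vertex Lines (cell (ray_pt j)) (cell (ray_pt (j + 1))) \<longleftrightarrow> s j = 1 \<and> s (j + 1) = -1"
proof
  assume "share_vertex Lines (cell (ray_pt j)) (cell (ray_pt (j + 1)))"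
  then obtain v where v: "v \<in> vertices Lines" "le v (ray_pt j)" "le v (ray_pt (j + 1))"
    unfolding share_vertex_def using vertex_mem_closure_cell_iff by blast
  have zero: "g j v = 0" "g (j + 1) v = 0"
    using v(1) le_ray_ptD[OF v(1,2)] le_ray_ptD[OF v(1,3)] g_pt_self by metis+
  have key: "0 \<le> sn n (m + 1) * s j - sn n m * s (j + 1) - sn n 1 * s (j - m)"
    if m: "1 \<le> m" "m \<le> int n - 2" for m
  proof -
    have "g (j - m) v = 0 \<or> sgn (g (j - m) v) = sgn (sn n m)"
      using v(2) m unfolding le_ray_pt_right_iff by auto
    then have "0 \<le> g (j - m) v" using sn_Suc_bounds(1)[OF m] by (auto simp: sgn_if split: if_splits)
    then have "0 \<le> sn n 1 * g (j - m) v" using sn_1_pos by simp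
    then show ?thesis unfolding g_interpolation[OF zero] .
  qed
  have "s j = s (j + 1) \<Longrightarrow> False"
  proof -
    assume eq: "s j = s (j + 1)"
    \<comment> \<open>Lines \<open>j\<close> and \<open>j + 1\<close> have the same sign, so the
      opposite sign occurs elsewhere in the window. If that sign is -1, stepping back by
      \<open>n\<close> turns it into the required 1.\<close>
    obtain m where m: "1 \<le> m" "m \<le> int n - 2" "s (j - m) = 1"
    proof (cases "s j = 1")
      case True
      obtain i where i: "j \<le> i" "i < j + int n" "s i = -1" using both_signs_in_window[of "-1" j] by auto
      then have "i \<noteq> j" "i \<noteq> j + 1" using True eq by auto
      moreover have "s (i - int n) = 1" using s_shift[of "i - int n"] i by simp
      ultimately show thesis using i that[of "j + int n - i"] by simp
    next
      case False
      then have "s j = -1" using s_cases by blast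
      obtain i where i: "j - int n + 2 \<le> i" "i < j - int n + 2 + int n" "s i = 1"
        using both_signs_in_window[of 1 "j - int n + 2"] by auto
      then have "i \<noteq> j" "i \<noteq> j + 1" using \<open>s j = -1\<close> eq by auto
      then show thesis using i that[of "j - i"] by simp
    qed
    show False
      using key[OF m(1,2)] sn_Suc_bounds(3,4)[OF m(1,2)] m(3) eq s_cases[of "j + 1"] by auto
  qed
  moreover have "\<not> (s j = -1 \<and> s (j + 1) = 1)"
    using key[of 1] sn_Suc_bounds[of 1] s_cases[of "j - 1"] n by auto
  ultimately show "s j = 1 \<and> s (j + 1) = -1" using s_cases[of j] s_cases[of "j + 1"] by auto
next
  assume s: "s j = 1 \<and> s (j + 1) = -1"
  have nd: "\<not> int n dvd (j + 1) - j" using n by simp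
  define v where "v = pt j (crossing j (j + 1))"
  have v: "v \<in> vertices Lines" unfolding v_def by (rule crossing_vertex[OF nd])
  have zero: "g j v = 0" "g (j + 1) v = 0"
    unfolding v_def using g_pt_crossing[OF nd] by simp_all
  have pos: "g (j - m) v > 0" if m: "1 \<le> m" "m \<le> int n - 2" for m
  proof -
    have "0 < sn n 1 * g (j - m) v"
      unfolding g_interpolation[OF zero] using s sn_Suc_bounds[OF m] s_cases[of "j - m"] sn_1_pos by auto
    then show ?thesis using sn_1_pos by (simp add: zero_less_mult_iff)
  qed
  \<comment> \<open>The index \<open>j - (n - 1)\<close> is \<open>j + 1\<close> shifted by
    \<open>- n\<close>, so \<open>m = n - 1\<close> names line \<open>j + 1\<close> again and only
    \<open>m \<le> n - 2\<close> gives third lines.\<close>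
  have zero': "g (j - (int n - 1)) v = 0" "g (j + 1 - 0) v = 0" "g (j + 1 - 1) v = 0" "g (j - 0) v = 0"
    using zero g_shift[of "j - (int n - 1)" v] by simp_all
  have "le v (ray_pt j)" unfolding le_ray_pt_right_iff
  proof
    fix m assume "m \<in> {0..<int n}"
    then consider "m = 0" | "m = int n - 1" | "1 \<le> m" "m \<le> int n - 2" by fastforce
    then show "g (j - m) v = 0 \<or> sgn (g (j - m) v) = sgn (sn n m)"
      by cases (use zero' pos sn_Suc_bounds in auto)
  qed
  moreover have "le v (ray_pt (j + 1))" unfolding le_ray_pt_right_iff
  proof
    fix m assume "m \<in> {0..<int n}"
    then consider "m = 0" | "m = 1" | "1 \<le> m - 1" "m - 1 \<le> int n - 2" by fastforce
    then show "g (j + 1 - m) v = 0 \<or> sgn (g (j + 1 - m) v) = sgn (sn n m)"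
    proof cases
      case 3
      then have "g (j - (m - 1)) v > 0" "sn n (m - 1 + 1) > 0" using pos sn_Suc_bounds by blast+
      then show ?thesis by (simp add: algebra_simps)
    qed (use zero' in auto)
  qed
  ultimately show "share_vertex Lines (cell (ray_pt j)) (cell (ray_pt (j + 1)))"
    unfolding share_vertex_def using v vertex_mem_closure_cell_iff by blast
qed

end

section \<open>Counting isomorphism classes\<close>

lemma isomorphic_arrangements_refl: "isomorphic_arrangements L L"
  unfolding isomorphic_arrangements_def by (intro exI[of _ id]) simp

definition descent :: "(int \<Rightarrow> real) \<Rightarrow> int \<Rightarrow> bool"
  where "descent s j \<longleftrightarrow> s j = 1 \<and> s (j + 1) = -1"

text \<open>If \<open>s j = 1\<close>, the descent at \<open>j\<close> reveals
  \<open>s (j + 1)\<close>. If \<open>s j = -1\<close>, then \<open>s (j + n) = 1\<close> and the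
  descent at \<open>j + n\<close> reveals \<open>- s (j + 1)\<close>. The known sign at 0 starts the
  induction.\<close>

lemma (in tangent_lines) s_eq_of_descent_eq:
  assumes "tangent_lines n s'" "\<And>j::nat. descent s (int j) \<longleftrightarrow> descent s' (int j)"
  shows "s (int j) = s' (int j)"
proof (induction j)
  case 0
  interpret B: tangent_lines n s' by (rule assms(1))
  show ?case using s012 B.s012 by simp
next
  case (Suc j)
  interpret B: tangent_lines n s' by (rule assms(1))
  show ?case
  proof (cases "s (int j) = 1")
    case True
    then show ?thesis
      using Suc assms(2)[of j] s_cases[of "int j + 1"] B.s_cases[of "int j + 1"]
      by (auto simp: descent_def add.commute)
  next
    case False
    then have "s (int j) = -1" "s' (int j) = -1" using s_cases[of "int j"] Suc by auto
    moreover have "int (j + n) = int j + int n" "int (j + n) + 1 = (int j + 1) + int n" by simp_all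
    ultimately have "descent s (int (j + n)) \<longleftrightarrow> s (int j + 1) = 1"
      "descent s' (int (j + n)) \<longleftrightarrow> s' (int j + 1) = 1"
      unfolding descent_def by (simp_all only: s_shift B.s_shift) auto
    then show ?thesis
      using assms(2)[of "j + n"] s_cases[of "int j + 1"] B.s_cases[of "int j + 1"]
      by (auto simp: add.commute)
  qed
qed

text \<open>A walk on a cycle with steps 1 and -1 that is never back after two steps cannot change
  direction.\<close>

lemma dihedral_of_steps:
  fixes \<sigma> :: "int \<Rightarrow> int" and N :: int
  assumes step: "\<And>j. N dvd \<sigma> (j + 1) - (\<sigma> j + 1) \<or> N dvd \<sigma> (j + 1) - (\<sigma> j - 1)"
    and no_return: "\<And>j. \<not> N dvd \<sigma> (j + 2) - \<sigma> j"
  obtains d where "d = 1 \<or> d = -1" "\<And>j::nat. N dvd \<sigma> (int j) - (\<sigma> 0 + d * int j)"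
proof -
  obtain d where d: "d = 1 \<or> d = -1" "N dvd \<sigma> 1 - (\<sigma> 0 + d)"
    using step[of 0] by (metis add_0 diff_conv_add_uminus)
  \<comment> \<open>Two consecutive positions are carried along, because the direction of the last
    step is what excludes turning back.\<close>
  have "N dvd \<sigma> (int j) - (\<sigma> 0 + d * int j) \<and> N dvd \<sigma> (int j + 1) - (\<sigma> 0 + d * (int j + 1))" for j
  proof (induction j)
    case 0
    then show ?case using d by simp
  next
    case (Suc j)
    then have a: "N dvd \<sigma> (int j) - (\<sigma> 0 + d * int j)"
      and b: "N dvd \<sigma> (int j + 1) - (\<sigma> 0 + d * (int j + 1))" by auto
    have c: "N dvd \<sigma> (int j + 2) - (\<sigma> (int j + 1) + d) \<or> N dvd \<sigma> (int j + 2) - (\<sigma> (int j + 1) - d)"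
      using step[of "int j + 1"] d(1) by (auto simp: add.assoc)
    have "\<not> N dvd \<sigma> (int j + 2) - (\<sigma> (int j + 1) - d)"
    proof
      assume e: "N dvd \<sigma> (int j + 2) - (\<sigma> (int j + 1) - d)"
      from dvd_diff[OF dvd_add[OF e b] a] show False
        using no_return[of "int j"] by (simp add: algebra_simps)
    qed
    with c have e: "N dvd \<sigma> (int j + 2) - (\<sigma> (int j + 1) + d)" by blast
    from dvd_add[OF e b] have "N dvd \<sigma> (int j + 2) - (\<sigma> 0 + d * (int j + 2))"
      by (simp add: algebra_simps)
    then show ?case using b by (simp add: add.assoc add.commute)
  qed
  then show thesis using that d(1) by blast
qed

lemma descent_dihedral:
  assumes "tangent_lines n s" "tangent_lines n s'"
    and iso: "isomorphic_arrangements (range (line_family.line (normal n) s))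
      (range (line_family.line (normal n) s'))"
  shows "\<exists>x\<in>{0..<2 * int n} \<times> UNIV. \<forall>j::nat. descent s (int j) \<longleftrightarrow>
    descent s' (if snd x then fst x + int j else fst x - int j - 1)"
proof -
  interpret A: tangent_lines n s by fact
  interpret B: tangent_lines n s' by fact
  let ?R = "\<lambda>j. A.cell (A.ray_pt j)" and ?R' = "\<lambda>j. B.cell (B.ray_pt j)"
  have n: "n \<ge> 5" by (rule A.n)
  from iso obtain f where f: "inj_on f (edges A.Lines)"
    "\<And>e. is_ray A.Lines e \<Longrightarrow> is_ray B.Lines (f e)"
    "\<And>e e'. e \<in> edges A.Lines \<Longrightarrow> e' \<in> edges A.Lines \<Longrightarrow>
      share_face A.Lines e e' \<Longrightarrow> share_face B.Lines (f e) (f e')"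
    "\<And>e e'. e \<in> edges A.Lines \<Longrightarrow> e' \<in> edges A.Lines \<Longrightarrow>
      share_vertex B.Lines (f e) (f e') \<longleftrightarrow> share_vertex A.Lines e e'"
    by (rule isomorphic_arrangements_edge_map) auto
  have "\<exists>k. f (?R j) = ?R' k" for j
    using f(2)[OF A.is_ray_cell_ray_pt] B.is_rayE by metis
  then obtain \<sigma> where \<sigma>: "\<And>j. f (?R j) = ?R' (\<sigma> j)" by metis
  have inj: "2 * int n dvd \<sigma> j - \<sigma> k \<longleftrightarrow> 2 * int n dvd j - k" for j k
    using inj_on_eq_iff[OF f(1) A.cell_ray_pt_mem_edges A.cell_ray_pt_mem_edges, of j k]
    unfolding \<sigma> A.cell_ray_pt_eq_iff B.cell_ray_pt_eq_iff .
  have small: "\<not> 2 * int n dvd m" if "m = 1 \<or> m = 2" for m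
    using that n by (auto dest: zdvd_imp_le)
  have "2 * int n dvd \<sigma> (j + 1) - (\<sigma> j + 1) \<or> 2 * int n dvd \<sigma> (j + 1) - (\<sigma> j - 1)" for j
  proof -
    have "share_face B.Lines (?R' (\<sigma> j)) (?R' (\<sigma> (j + 1)))"
      using f(3)[OF A.cell_ray_pt_mem_edges A.cell_ray_pt_mem_edges A.share_face_ray_Suc]
      unfolding \<sigma> .
    then show ?thesis using B.share_face_rayD inj[of "j + 1" j] small[of 1] by fastforce
  qed
  moreover have "\<not> 2 * int n dvd \<sigma> (j + 2) - \<sigma> j" for j
    using inj[of "j + 2" j] small[of 2] by simp
  ultimately obtain d where d: "d = 1 \<or> d = -1"
    "\<And>j::nat. 2 * int n dvd \<sigma> (int j) - (\<sigma> 0 + d * int j)"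
    using dihedral_of_steps by blast
  define c where "c = \<sigma> 0 mod (2 * int n)"
  have c: "c \<in> {0..<2 * int n}" using n by (simp add: c_def)
  have R': "?R' (\<sigma> (int j)) = ?R' (c + d * int j)" for j
  proof -
    have "2 * int n dvd \<sigma> 0 - c" unfolding c_def by (rule dvd_minus_mod)
    from dvd_add[OF d(2) this] show ?thesis
      unfolding B.cell_ray_pt_eq_iff by (simp add: algebra_simps)
  qed
  have desc: "descent s (int j) \<longleftrightarrow>
      share_vertex B.Lines (?R' (c + d * int j)) (?R' (c + d * int (Suc j)))" for j
    using f(4)[OF A.cell_ray_pt_mem_edges A.cell_ray_pt_mem_edges, of "int j" "int j + 1"]
      R'[of j] R'[of "Suc j"] A.share_vertex_ray_Suc_iff[of "int j"]
    unfolding \<sigma> by (simp add: descent_def add.commute)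
  have "descent s (int j) \<longleftrightarrow>
      descent s' (if d = 1 then c + int j else c - int j - 1)" for j
  proof (cases "d = 1")
    case True
    then show ?thesis using desc[of j] B.share_vertex_ray_Suc_iff[of "c + int j"]
      by (simp add: descent_def algebra_simps)
  next
    case False
    then have "d = -1" using d(1) by blast
    have comm: "share_vertex L e e' \<longleftrightarrow> share_vertex L e' e" for L e e'
      by (auto simp: share_vertex_def)
    \<comment> \<open>A reflection sends the ends \<open>j\<close> and \<open>j + 1\<close> to
      \<open>c - j\<close> and \<open>c - j - 1\<close>. A descent is recorded at the smaller index,
      hence the additional -1.\<close>
    have "c + d * int j = (c - int j - 1) + 1" "c + d * int (Suc j) = c - int j - 1"
      using \<open>d = -1\<close> by simp_all
    then show ?thesis using desc[of j] comm B.share_vertex_ray_Suc_iff[of "c - int j - 1"] False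
      by (simp only: descent_def if_False)
  qed
  then show ?thesis using c by (intro bexI[of _ "(c, d = 1)"]) auto
qed

text \<open>The second factor fixes one period: 1 at 0, 2 and the elements of \<open>P\<close>, and
  -1 elsewhere, in particular at 1 when \<open>P \<subseteq> {3..<int n}\<close>. The first factor
  extends it antiperiodically.\<close>

definition sign_sequence :: "nat \<Rightarrow> int set \<Rightarrow> int \<Rightarrow> real"
  where "sign_sequence n P i = (if even (i div int n) then 1 else -1) *
    (if i mod int n \<in> insert 0 (insert 2 P) then 1 else -1)"

lemma tangent_lines_sign_sequence:
  assumes "5 \<le> n" "P \<subseteq> {3..<int n}"
  shows "tangent_lines n (sign_sequence n P)"
proof
  show "5 \<le> n" by fact
  show "sign_sequence n P i = 1 \<or> sign_sequence n P i = -1" for i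
    by (simp add: sign_sequence_def)
  show "sign_sequence n P (i + int n) = - sign_sequence n P i" for i
    using assms(1) by (simp add: sign_sequence_def)
  show "sign_sequence n P 0 = 1" "sign_sequence n P 1 = -1" "sign_sequence n P 2 = 1"
    using assms by (auto simp: sign_sequence_def)
qed

lemma sign_sequence_inj:
  assumes "P \<subseteq> {3..<int n}" "Q \<subseteq> {3..<int n}"
    and "\<And>j::nat. sign_sequence n P (int j) = sign_sequence n Q (int j)"
  shows "P = Q"
proof -
  have "i \<in> P \<longleftrightarrow> i \<in> Q" if "i \<in> {3..<int n}" for i
  proof -
    have "sign_sequence n P i = sign_sequence n Q i"
      using assms(3)[of "nat i"] that by simp
    moreover have "i mod int n = i" "i div int n = 0" "i \<noteq> 0" "i \<noteq> 2" using that by auto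
    ultimately show ?thesis by (simp add: sign_sequence_def split: if_splits)
  qed
  then show ?thesis using assms(1,2) by (intro set_eqI) (meson subsetD)
qed

text \<open>Take a maximal set \<open>G\<close> of pairwise unrelated elements. By maximality every
  element of \<open>S\<close> is related to a member of \<open>G\<close>, so \<open>card G\<close>
  sets of size at most \<open>k\<close> cover \<open>S\<close>.\<close>

lemma large_independent_subset:
  assumes "finite S" and refl: "\<And>x. x \<in> S \<Longrightarrow> R x x"
    and sym: "\<And>x y. x \<in> S \<Longrightarrow> y \<in> S \<Longrightarrow> R x y \<Longrightarrow> R y x"
    and few: "\<And>x. x \<in> S \<Longrightarrow> card {y \<in> S. R y x} \<le> k"
  obtains G where "G \<subseteq> S" "pairwise (\<lambda>x y. \<not> R x y) G" "card S \<le> card G * k"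
proof -
  let ?F = "{G. G \<subseteq> S \<and> pairwise (\<lambda>x y. \<not> R x y) G}"
  have "finite ?F" using assms(1) by simp
  moreover have "{} \<in> ?F" by simp
  then have "?F \<noteq> {}" by (metis empty_iff)
  ultimately have "\<exists>G\<in>?F. \<forall>G'\<in>?F. G \<subseteq> G' \<longrightarrow> G = G'" by (rule finite_has_maximal)
  then obtain G where G: "G \<in> ?F" and max: "\<forall>G'\<in>?F. G \<subseteq> G' \<longrightarrow> G = G'"
    by (rule bexE)
  have "S \<subseteq> (\<Union>x\<in>G. {y \<in> S. R y x})"
  proof
    fix y assume y: "y \<in> S"
    have "\<exists>x\<in>G. R y x"
    proof (rule ccontr)
      assume no: "\<not> ?thesis"
      then have "\<not> R x y" if "x \<in> G" for x using sym G y that by blast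
      then have ins: "insert y G \<in> ?F" using G y no by (auto simp: pairwise_insert)
      have "G = insert y G" using bspec[OF max ins] subset_insertI by (rule mp)
      then show False using no refl y by blast
    qed
    then show "y \<in> (\<Union>x\<in>G. {y \<in> S. R y x})" using y by blast
  qed
  moreover have "finite G" using G assms(1) finite_subset by blast
  moreover from this have "finite (\<Union>x\<in>G. {y \<in> S. R y x})" using assms(1) by simp
  ultimately have "card S \<le> (\<Sum>x\<in>G. card {y \<in> S. R y x})"
    using card_mono[of "\<Union>x\<in>G. {y \<in> S. R y x}" S] card_UN_le[of G "\<lambda>x. {y \<in> S. R y x}"] by linarith
  also have "\<dots> \<le> of_nat (card G) * k"
    by (rule sum_bounded_above) (use few G in blast)
  finally show thesis using that[of G] G by simp
qed

section \<open>The exponential lower bound\<close>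

lemma many_arrangements:
  assumes n: "5 \<le> n"
  shows "\<exists>F. F \<subseteq> {L \<in> one_ge5gon_arrangements. card L = n} \<and> finite F \<and>
      pairwise (\<lambda>L M. \<not> isomorphic_arrangements L M) F \<and> 2 ^ n \<le> card F * (32 * n)"
proof -
  define T where "T P = range (line_family.line (normal n) (sign_sequence n P))" for P
  let ?S = "Pow {3..<int n}"
  have tl: "tangent_lines n (sign_sequence n P)" if "P \<in> ?S" for P
    using tangent_lines_sign_sequence n that by blast
  have few: "card {P \<in> ?S. isomorphic_arrangements (T P) (T Q)} \<le> 4 * n" if Q: "Q \<in> ?S" for Q
  proof -
    let ?C = "{P \<in> ?S. isomorphic_arrangements (T P) (T Q)}"
    let ?D = "{0..<2 * int n} \<times> (UNIV :: bool set)"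
    have "\<forall>P\<in>?C. \<exists>x\<in>?D. \<forall>j::nat. descent (sign_sequence n P) (int j) \<longleftrightarrow>
        descent (sign_sequence n Q) (if snd x then fst x + int j else fst x - int j - 1)"
    proof
      fix P assume "P \<in> ?C"
      then show "\<exists>x\<in>?D. \<forall>j::nat. descent (sign_sequence n P) (int j) \<longleftrightarrow>
          descent (sign_sequence n Q) (if snd x then fst x + int j else fst x - int j - 1)"
        using tl Q by (intro descent_dihedral) (auto simp: T_def)
    qed
    then obtain \<phi> where \<phi>: "\<And>P. P \<in> ?C \<Longrightarrow> \<phi> P \<in> ?D"
      "\<And>P j. P \<in> ?C \<Longrightarrow> descent (sign_sequence n P) (int j) \<longleftrightarrow>
        descent (sign_sequence n Q) (if snd (\<phi> P) then fst (\<phi> P) + int j else fst (\<phi> P) - int j - 1)"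
      by (metis (no_types, lifting))
    \<comment> \<open>If the same symmetry carries two choices to \<open>Q\<close>, they have the
      same descents and therefore coincide. So the class is no larger than the set of pairs of a
      starting end and an orientation.\<close>
    have "inj_on \<phi> ?C"
    proof (rule inj_onI)
      fix P P' assume P: "P \<in> ?C" "P' \<in> ?C" "\<phi> P = \<phi> P'"
      then have "descent (sign_sequence n P) (int j) \<longleftrightarrow> descent (sign_sequence n P') (int j)" for j
        using \<phi>(2)[OF P(1), of j] \<phi>(2)[OF P(2), of j] by simp
      then have "sign_sequence n P (int j) = sign_sequence n P' (int j)" for j
        using tangent_lines.s_eq_of_descent_eq[of n "sign_sequence n P" "sign_sequence n P'"] tl P
        by blast
      then show "P = P'" using sign_sequence_inj P by blast
    qed
    then have "card ?C \<le> card ?D" 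
      by (rule card_inj_on_le[OF _ image_subsetI[OF \<phi>(1)]]) simp_all
    also have "\<dots> = 4 * n" by (simp add: card_cartesian_product)
    finally show ?thesis .
  qed
  obtain G where G: "G \<subseteq> ?S" "pairwise (\<lambda>P Q. \<not> isomorphic_arrangements (T P) (T Q)) G"
    "card ?S \<le> card G * (4 * n)"
    by (rule large_independent_subset[of ?S "\<lambda>P Q. isomorphic_arrangements (T P) (T Q)" "4 * n"])
      (use few isomorphic_arrangements_refl isomorphic_arrangements_sym in auto)
  have "inj_on T G"
  proof (rule inj_onI, rule ccontr)
    fix P Q assume PQ: "P \<in> G" "Q \<in> G" and eq: "T P = T Q" and neq: "P \<noteq> Q"
    have "\<not> isomorphic_arrangements (T P) (T Q)" by (rule pairwiseD(1)[OF G(2) PQ neq])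
    then show False unfolding eq using isomorphic_arrangements_refl by simp
  qed
  then have card: "card (T ` G) = card G" by (rule card_image)
  have "T P \<in> one_ge5gon_arrangements \<and> card (T P) = n" if "P \<in> G" for P
  proof -
    have "P \<in> ?S" using that G(1) by (rule subsetD[rotated])
    then show ?thesis
      unfolding T_def using tangent_lines.Lines_mem[OF tl] tangent_lines.card_Lines[OF tl] by simp
  qed
  then have "T ` G \<subseteq> {L \<in> one_ge5gon_arrangements. card L = n}" by blast
  moreover have "finite (T ` G)" using finite_subset[OF G(1)] by simp
  moreover have "pairwise (\<lambda>L M. \<not> isomorphic_arrangements L M) (T ` G)"
    by (rule pairwise_imageI) (use pairwiseD(1)[OF G(2)] in simp)
  moreover have "2 ^ n \<le> card (T ` G) * (32 * n)"
  proof -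
    have "card ?S = 2 ^ (n - 3)" using n by (simp add: card_Pow nat_diff_distrib)
    \<comment> \<open>The factor 8 restores the three prescribed signs, and 8 times
      \<open>4 * n\<close> is \<open>32 * n\<close>.\<close>
    then have "8 * 2 ^ (n - 3) \<le> card G * (32 * n)" using G(3) by (simp add: mult_ac)
    moreover have "(2::nat) ^ n = 2 ^ 3 * 2 ^ (n - 3)"
      using n by (subst power_add[symmetric]) simp
    ultimately show ?thesis using card by simp
  qed
  ultimately show ?thesis by blast
qed

theorem mainTheorem5:
  shows "\<exists>b::real. b > 1 \<and> (\<exists>N::nat. \<forall>n\<ge>N.
    \<exists>F. F \<subseteq> {L \<in> one_ge5gon_arrangements. card L = n} \<and> finite F \<and>
      pairwise (\<lambda>L M. \<not> isomorphic_arrangements L M) F \<and>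
      b ^ n \<le> real (card F))"
proof -
  \<comment> \<open>The product of 3/2 and 4/3 is 2, so once \<open>(4 / 3) ^ n\<close> exceeds
    \<open>32 * n\<close> the base 3/2 remains. Any base strictly between 1 and 2 could take its
    place, with a suitable companion.\<close>
  have "(\<lambda>n. real n / (4 / 3) ^ n) \<longlonglongrightarrow> 0" by (rule lim_n_over_pown) simp
  then have "\<forall>\<^sub>F n in sequentially. real n / (4 / 3) ^ n < 1 / 32"
    by (rule order_tendstoD) simp
  then obtain N where N: "\<And>n. n \<ge> N \<Longrightarrow> real n / (4 / 3) ^ n < 1 / 32"
    by (auto simp: eventually_sequentially)
  have "\<exists>F. F \<subseteq> {L \<in> one_ge5gon_arrangements. card L = n} \<and> finite F \<and>
      pairwise (\<lambda>L M. \<not> isomorphic_arrangements L M) F \<and> (3 / 2) ^ n \<le> real (card F)"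
    if n: "n \<ge> max N 5" for n
  proof -
    from n have "5 \<le> n" by simp
    then obtain F where F: "F \<subseteq> {L \<in> one_ge5gon_arrangements. card L = n}" "finite F"
      "pairwise (\<lambda>L M. \<not> isomorphic_arrangements L M) F" "2 ^ n \<le> card F * (32 * n)"
      using many_arrangements by blast
    have "real n / (4 / 3) ^ n < 1 / 32" using N n by simp
    then have "32 * real n \<le> (4 / 3) ^ n" by (simp add: field_simps)
    then have "(3 / 2) ^ n * (32 * real n) \<le> (3 / 2) ^ n * (4 / 3) ^ n"
      by (intro mult_left_mono) simp_all
    also have "\<dots> = 2 ^ n" by (simp flip: power_mult_distrib)
    also have "\<dots> = real (2 ^ n)" by simp
    also have "\<dots> \<le> real (card F * (32 * n))" using F(4) by (rule of_nat_mono)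
    finally have "(3 / 2) ^ n * (32 * real n) \<le> real (card F) * (32 * real n)" by simp
    then have "(3 / 2) ^ n \<le> real (card F)" using n by simp
    then show ?thesis using F by blast
  qed
  then show ?thesis by (intro exI[of _ "3 / 2"] conjI exI[of _ "max N 5"]) auto
qed

end
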